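(* Let $1<p_1\le 2\le p_2<\infty$ with $\frac{1}{p_1}-\frac{1}{p_2}<\frac14$, let $X$ be a Banach space of type $p_1$ and cotype $p_2$, and let $n\ge 3$, $m\ge 1$ be integers. Then there is $q_0$ such that for every prime $q\ge q_0$ the Steinberg group $St_n(\mathbb{F}_q[t_1,\dots,t_m])$ has property $F_X$.
   Context: Banach spaces are complex. $X$ has (Gaussian) type $p_1$ if there is a constant $T$ such that for all $k$, all $x_1,\dots,x_k\in X$ and independent standard Gaussian random variables $g_1,\dots,g_k$ on a probability space $(\Omega,P)$, $\left(\int_\Omega\|\sum_i g_i(\omega)x_i\|^2dP\right)^{1/2}\le T\left(\sum_i\|x_i\|^{p_1}\right)^{1/p_1}$. It has (Gaussian) cotype $p_2$ if there is a constant $C>0$ such that always $\left(\sum_i\|x_i\|^{p_2}\right)^{1/p_2}\le C\left(\int_\Omega\|\sum_i g_i(\omega)x_i\|^2dP\right)^{1/2}$. For a ring $R$ and $n\ge3$, the Steinberg group $St_n(R)$ is the (discrete) group generated by symbols $x_{i,j}(s)$, $1\le i\ne j\le n$, $s\in R$, with defining relations $x_{i,j}(s_1)x_{i,j}(s_2)=x_{i,j}(s_1+s_2)$ and, for $i\ne l$, $[x_{i,j}(s_1),x_{k,l}(s_2)]=1$ if $j\ne k$ and $=x_{i,l}(s_1s_2)$ if $j=k$. $\mathbb{F}_q[t_1,\dots,t_m]$ is the polynomial ring over the field with $q$ elements. A topological group $G$ has property $F_X$ if every continuous affine isometric action of $G$ on $X$ has a fixed point. *)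

theory Defs
  imports
    "HOL-Probability.Probability"
    "HOL-Algebra.Indexed_Polynomials"
    "HOL-Algebra.Group_Action"
    "HOL-Number_Theory.Residues"
begin

section \<open>Complex Banach spaces\<close>

class complex_banach = banach +
  fixes scaleC :: "complex \<Rightarrow> 'a \<Rightarrow> 'a"  (infixr \<open>*\<^sub>C\<close> 75)
  assumes scaleC_add_right: "a *\<^sub>C (x + y) = a *\<^sub>C x + a *\<^sub>C y"
    and scaleC_add_left: "(a + b) *\<^sub>C x = a *\<^sub>C x + b *\<^sub>C x"
    and scaleC_scaleC: "a *\<^sub>C (b *\<^sub>C x) = (a * b) *\<^sub>C x"
    and scaleC_one: "1 *\<^sub>C x = x"
    and scaleR_scaleC: "r *\<^sub>R x = complex_of_real r *\<^sub>C x"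
    and norm_scaleC: "norm (a *\<^sub>C x) = cmod a * norm x"

instantiation complex :: complex_banach
begin
definition "scaleC_complex (a :: complex) (x :: complex) = a * x"
instance
  by standard (auto simp: scaleC_complex_def algebra_simps norm_mult scaleR_conv_of_real)
end

definition complex_linear :: "('x::complex_banach \<Rightarrow> 'x) \<Rightarrow> bool" where
  "complex_linear L \<longleftrightarrow> (\<forall>x y. L (x + y) = L x + L y) \<and> (\<forall>a x. L (a *\<^sub>C x) = a *\<^sub>C L x)"

definition complex_affine :: "('x::complex_banach \<Rightarrow> 'x) \<Rightarrow> bool" where
  "complex_affine f \<longleftrightarrow> (\<exists>L b. complex_linear L \<and> (\<forall>x. f x = L x + b))"


section \<open>Gaussian type and cotype\<close>

definition iid_std_gaussians :: "'w measure \<Rightarrow> nat \<Rightarrow> (nat \<Rightarrow> 'w \<Rightarrow> real) \<Rightarrow> bool" where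
  "iid_std_gaussians M k g \<longleftrightarrow>
     prob_space.indep_vars M (\<lambda>_. borel) g {..<k} \<and>
     (\<forall>i<k. distributed M lborel (g i) std_normal_density)"

definition gaussian_L2_norm ::
    "'w measure \<Rightarrow> nat \<Rightarrow> (nat \<Rightarrow> 'w \<Rightarrow> real) \<Rightarrow> (nat \<Rightarrow> 'x::real_normed_vector) \<Rightarrow> real" where
  "gaussian_L2_norm M k g x = sqrt (\<integral>\<omega>. (norm (\<Sum>i<k. g i \<omega> *\<^sub>R x i))\<^sup>2 \<partial>M)"

text \<open>
  A definition cannot quantify over the type of the sample space. The type
  \<^typ>\<open>nat \<Rightarrow> real\<close> carries Gaussian sequences (on a product measure), and the
  quantities below only depend on the joint law of the Gaussian variables,
  so fixing this type is no restriction.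
\<close>

definition gaussian_type :: "'x::complex_banach itself \<Rightarrow> real \<Rightarrow> bool" where
  "gaussian_type tx p \<longleftrightarrow>
     (\<exists>T. \<forall>(k::nat) (x :: nat \<Rightarrow> 'x) (M :: (nat \<Rightarrow> real) measure) g.
        prob_space M \<longrightarrow> iid_std_gaussians M k g \<longrightarrow>
        gaussian_L2_norm M k g x \<le> T * (\<Sum>i<k. norm (x i) powr p) powr (1 / p))"

definition gaussian_cotype :: "'x::complex_banach itself \<Rightarrow> real \<Rightarrow> bool" where
  "gaussian_cotype tx p \<longleftrightarrow>
     (\<exists>C>0. \<forall>(k::nat) (x :: nat \<Rightarrow> 'x) (M :: (nat \<Rightarrow> real) measure) g.
        prob_space M \<longrightarrow> iid_std_gaussians M k g \<longrightarrow>
        (\<Sum>i<k. norm (x i) powr p) powr (1 / p) \<le> C * gaussian_L2_norm M k g x)"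


section \<open>Property \<open>F\<^sub>X\<close>\<close>

text \<open>A topological group is given by a group \<open>G\<close> and a topology \<open>\<tau>\<close> on its carrier.\<close>

definition affine_isometric_action ::
    "('g, 'b) monoid_scheme \<Rightarrow> 'g topology \<Rightarrow> ('g \<Rightarrow> 'x::complex_banach \<Rightarrow> 'x) \<Rightarrow> bool" where
  "affine_isometric_action G \<tau> \<phi> \<longleftrightarrow>
     group_action G UNIV \<phi> \<and>
     (\<forall>g\<in>carrier G. complex_affine (\<phi> g) \<and> (\<forall>x y. dist (\<phi> g x) (\<phi> g y) = dist x y)) \<and>
     continuous_map (prod_topology \<tau> euclidean) euclidean (\<lambda>(g, x). \<phi> g x)"

definition property_F ::
    "'x::complex_banach itself \<Rightarrow> ('g, 'b) monoid_scheme \<Rightarrow> 'g topology \<Rightarrow> bool" where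
  "property_F tx G \<tau> \<longleftrightarrow>
     (\<forall>\<phi> :: 'g \<Rightarrow> 'x \<Rightarrow> 'x. affine_isometric_action G \<tau> \<phi> \<longrightarrow>
        (\<exists>x. \<forall>g\<in>carrier G. \<phi> g x = x))"


section \<open>Groups given by generators and relations\<close>

text \<open>
  Words over \<open>S\<close> are lists of pairs \<open>(s, e)\<close>, where \<open>(s, True)\<close> stands for the
  generator \<open>s\<close> and \<open>(s, False)\<close> for its inverse. A relation \<open>(r, r')\<close> stands for
  the equation \<open>r = r'\<close> between words.
\<close>

definition words :: "'s set \<Rightarrow> ('s \<times> bool) list set" where
  "words S = lists (S \<times> UNIV)"

inductive_set word_rel ::
    "'s set \<Rightarrow> (('s \<times> bool) list \<times> ('s \<times> bool) list) set
      \<Rightarrow> (('s \<times> bool) list \<times> ('s \<times> bool) list) set"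
  for S Rels where
  refl: "u \<in> words S \<Longrightarrow> (u, u) \<in> word_rel S Rels"
| sym: "(u, v) \<in> word_rel S Rels \<Longrightarrow> (v, u) \<in> word_rel S Rels"
| trans: "(u, v) \<in> word_rel S Rels \<Longrightarrow> (v, w) \<in> word_rel S Rels \<Longrightarrow> (u, w) \<in> word_rel S Rels"
| cancel: "u \<in> words S \<Longrightarrow> v \<in> words S \<Longrightarrow> s \<in> S \<Longrightarrow>
    (u @ [(s, e), (s, \<not> e)] @ v, u @ v) \<in> word_rel S Rels"
| rel: "u \<in> words S \<Longrightarrow> v \<in> words S \<Longrightarrow> (r, r') \<in> Rels \<Longrightarrow> r \<in> words S \<Longrightarrow> r' \<in> words S \<Longrightarrow>
    (u @ r @ v, u @ r' @ v) \<in> word_rel S Rels"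

definition presented_group ::
    "'s set \<Rightarrow> (('s \<times> bool) list \<times> ('s \<times> bool) list) set \<Rightarrow> ('s \<times> bool) list set monoid" where
  "presented_group S Rels =
     \<lparr> carrier = words S // word_rel S Rels,
       mult = (\<lambda>A B. \<Union>a\<in>A. \<Union>b\<in>B. word_rel S Rels `` {a @ b}),
       one = word_rel S Rels `` {[]} \<rparr>"

lemma words_append [simp]: "u @ v \<in> words S \<longleftrightarrow> u \<in> words S \<and> v \<in> words S"
  by (auto simp: words_def)

lemma words_Nil [simp]: "[] \<in> words S"
  by (auto simp: words_def)

lemma words_Cons [simp]: "x # v \<in> words S \<longleftrightarrow> fst x \<in> S \<and> v \<in> words S"
  by (cases x) (auto simp: words_def)

lemma word_rel_words: "(u, v) \<in> word_rel S Rels \<Longrightarrow> u \<in> words S \<and> v \<in> words S"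
  by (induction rule: word_rel.induct) auto

lemma equiv_word_rel: "equiv (words S) (word_rel S Rels)"
proof (rule equivI)
  show "word_rel S Rels \<subseteq> words S \<times> words S" by (auto dest: word_rel_words)
  show "refl_on (words S) (word_rel S Rels)" by (rule refl_onI) (rule word_rel.refl)
  show "sym (word_rel S Rels)" by (rule symI) (rule word_rel.sym)
  show "trans (word_rel S Rels)" by (rule transI) (rule word_rel.trans)
qed

lemma word_rel_context:
  "(u, v) \<in> word_rel S Rels \<Longrightarrow> a \<in> words S \<Longrightarrow> b \<in> words S \<Longrightarrow>
     (a @ u @ b, a @ v @ b) \<in> word_rel S Rels"
proof (induction rule: word_rel.induct)
  case (refl u)
  then show ?case by (simp add: word_rel.refl)
next
  case (sym u v)
  then show ?case by (simp add: word_rel.sym)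
next
  case (trans u v w)
  then show ?case by (metis word_rel.trans)
next
  case (cancel u v s e)
  then show ?case using word_rel.cancel[of "a @ u" S "v @ b" s e Rels] by simp
next
  case (rel u v r r')
  then show ?case using word_rel.rel[of "a @ u" S "v @ b" r r' Rels] by simp
qed

lemma word_rel_append:
  assumes "(u, u') \<in> word_rel S Rels" "(v, v') \<in> word_rel S Rels"
  shows "(u @ v, u' @ v') \<in> word_rel S Rels"
proof -
  have "(u @ v, u' @ v) \<in> word_rel S Rels" "(u' @ v, u' @ v') \<in> word_rel S Rels"
    using word_rel_context[OF assms(1), of "[]" v] word_rel_context[OF assms(2), of u' "[]"]
      assms[THEN word_rel_words] by auto
  then show ?thesis by (rule word_rel.trans)
qed

lemma presented_group_mult:
  assumes "u \<in> words S" "v \<in> words S"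
  shows "word_rel S Rels `` {u} \<otimes>\<^bsub>presented_group S Rels\<^esub> word_rel S Rels `` {v}
    = word_rel S Rels `` {u @ v}"
proof -
  have "word_rel S Rels `` {a @ b} = word_rel S Rels `` {u @ v}"
    if "(u, a) \<in> word_rel S Rels" "(v, b) \<in> word_rel S Rels" for a b
    using equiv_class_eq[OF equiv_word_rel] word_rel_append[OF that] by metis
  moreover have "(u, u) \<in> word_rel S Rels" "(v, v) \<in> word_rel S Rels"
    using assms by (auto intro: word_rel.refl)
  ultimately have "(\<Union>a\<in>word_rel S Rels `` {u}. \<Union>b\<in>word_rel S Rels `` {v}.
      word_rel S Rels `` {a @ b}) = word_rel S Rels `` {u @ v}"
    by blast
  then show ?thesis
    by (simp add: presented_group_def)
qed

lemma word_inverse: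
  "u \<in> words S \<Longrightarrow> \<exists>v\<in>words S. (v @ u, []) \<in> word_rel S Rels"
proof (induction u)
  case Nil
  then show ?case by (intro bexI[of _ "[]"]) (auto intro: word_rel.refl)
next
  case (Cons x u)
  then obtain v where v: "v \<in> words S" "(v @ u, []) \<in> word_rel S Rels" by auto
  obtain s e where x: "x = (s, e)" by (cases x)
  have "(v @ [(s, \<not> e), (s, \<not> \<not> e)] @ u, v @ u) \<in> word_rel S Rels"
    using Cons.prems v x by (intro word_rel.cancel) auto
  then have "((v @ [(s, \<not> e)]) @ x # u, []) \<in> word_rel S Rels"
    using word_rel.trans[OF _ v(2)] x by simp
  then show ?case using v Cons.prems x by (intro bexI[of _ "v @ [(s, \<not> e)]"]) auto
qed

lemma group_presented_group: "group (presented_group S Rels)"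
proof (rule groupI)
  let ?G = "presented_group S Rels" and ?c = "\<lambda>u. word_rel S Rels `` {u}"
  have car: "A \<in> carrier ?G \<longleftrightarrow> (\<exists>u\<in>words S. A = ?c u)" for A
    by (auto simp: presented_group_def quotient_def)
  have one: "\<one>\<^bsub>?G\<^esub> = ?c []"
    by (simp add: presented_group_def)
  note mult = presented_group_mult[of _ S _ Rels]
  show "\<one>\<^bsub>?G\<^esub> \<in> carrier ?G" using car one by auto
  show "A \<otimes>\<^bsub>?G\<^esub> B \<in> carrier ?G" if "A \<in> carrier ?G" "B \<in> carrier ?G" for A B
    using that unfolding car by (metis mult words_append)
  show "A \<otimes>\<^bsub>?G\<^esub> B \<otimes>\<^bsub>?G\<^esub> C = A \<otimes>\<^bsub>?G\<^esub> (B \<otimes>\<^bsub>?G\<^esub> C)"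
    if "A \<in> carrier ?G" "B \<in> carrier ?G" "C \<in> carrier ?G" for A B C
    using that unfolding car by (auto simp: mult)
  show "\<one>\<^bsub>?G\<^esub> \<otimes>\<^bsub>?G\<^esub> A = A" if "A \<in> carrier ?G" for A
    using that unfolding car one by (auto simp: mult)
  show "\<exists>B\<in>carrier ?G. B \<otimes>\<^bsub>?G\<^esub> A = \<one>\<^bsub>?G\<^esub>" if A: "A \<in> carrier ?G" for A
  proof -
    obtain u where u: "u \<in> words S" "A = ?c u" using A car by auto
    obtain v where v: "v \<in> words S" "(v @ u, []) \<in> word_rel S Rels"
      using word_inverse[OF u(1)] by blast
    have "?c v \<otimes>\<^bsub>?G\<^esub> A = \<one>\<^bsub>?G\<^esub>"
      using mult[OF v(1) u(1)] equiv_class_eq[OF equiv_word_rel v(2)] u one by simp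
    then show ?thesis using v car by blast
  qed
qed


section \<open>Steinberg groups\<close>

text \<open>The generator \<open>x\<^sub>i\<^sub>j(s)\<close> is the triple \<open>(i, j, s)\<close>.\<close>

definition steinberg_gens :: "nat \<Rightarrow> ('a, 'b) ring_scheme \<Rightarrow> (nat \<times> nat \<times> 'a) set" where
  "steinberg_gens n R = {(i, j, s). i \<in> {1..n} \<and> j \<in> {1..n} \<and> i \<noteq> j \<and> s \<in> carrier R}"

definition commutator_word :: "'s \<Rightarrow> 's \<Rightarrow> ('s \<times> bool) list" where
  "commutator_word x y = [(x, True), (y, True), (x, False), (y, False)]"

definition steinberg_rels ::
    "nat \<Rightarrow> ('a, 'b) ring_scheme
      \<Rightarrow> (((nat \<times> nat \<times> 'a) \<times> bool) list \<times> ((nat \<times> nat \<times> 'a) \<times> bool) list) set" where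
  "steinberg_rels n R =
     {([((i, j, s1), True), ((i, j, s2), True)], [((i, j, s1 \<oplus>\<^bsub>R\<^esub> s2), True)]) | i j s1 s2.
        (i, j, s1) \<in> steinberg_gens n R \<and> (i, j, s2) \<in> steinberg_gens n R} \<union>
     {(commutator_word (i, j, s1) (k, l, s2), []) | i j k l s1 s2.
        (i, j, s1) \<in> steinberg_gens n R \<and> (k, l, s2) \<in> steinberg_gens n R \<and> i \<noteq> l \<and> j \<noteq> k} \<union>
     {(commutator_word (i, j, s1) (k, l, s2), [((i, l, s1 \<otimes>\<^bsub>R\<^esub> s2), True)]) | i j k l s1 s2.
        (i, j, s1) \<in> steinberg_gens n R \<and> (k, l, s2) \<in> steinberg_gens n R \<and> i \<noteq> l \<and> j = k}"

definition steinberg_group ::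
    "nat \<Rightarrow> ('a, 'b) ring_scheme \<Rightarrow> ((nat \<times> nat \<times> 'a) \<times> bool) list set monoid" where
  "steinberg_group n R = presented_group (steinberg_gens n R) (steinberg_rels n R)"

lemma group_steinberg_group: "group (steinberg_group n R)"
  unfolding steinberg_group_def by (rule group_presented_group)


section \<open>Polynomial rings in several variables\<close>

text \<open>
  Following \<^theory>\<open>HOL-Algebra.Indexed_Polynomials\<close>, monomials in the variables
  \<open>t\<^sub>i\<close>, \<open>i \<in> I\<close>, are finite multisets over \<open>I\<close>, and a polynomial maps monomials to
  coefficients.
\<close>

definition (in ring) indexed_mult ::
    "('i multiset \<Rightarrow> 'a) \<Rightarrow> ('i multiset \<Rightarrow> 'a) \<Rightarrow> ('i multiset \<Rightarrow> 'a)" where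
  "indexed_mult P Q = (\<lambda>m. \<Oplus>a\<in>{a. a \<subseteq># m}. P a \<otimes> Q (m - a))"

definition indexed_poly_ring ::
    "('a, 'b) ring_scheme \<Rightarrow> 'i set \<Rightarrow> ('i multiset \<Rightarrow> 'a) ring" where
  "indexed_poly_ring R I =
     \<lparr> carrier = ring.indexed_pset R I (carrier R),
       mult = ring.indexed_mult R,
       one = ring.indexed_const R \<one>\<^bsub>R\<^esub>,
       zero = ring.indexed_const R \<zero>\<^bsub>R\<^esub>,
       add = ring.indexed_padd R \<rparr>"

lemma finite_submultisets: "finite {a. a \<subseteq># m}"
proof (induction m)
  case (add x m)
  have "a \<in> {a. a \<subseteq># m} \<union> add_mset x ` {a. a \<subseteq># m}" if "a \<subseteq># add_mset x m" for a
  proof (cases "x \<in># a")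
    case True
    then obtain b where "a = add_mset x b" by (metis insert_DiffM)
    with that show ?thesis by auto
  next
    case False
    with that have "a \<subseteq># m"
      by (metis diff_single_trivial subset_eq_diff_conv add_mset_add_single)
    then show ?thesis by simp
  qed
  then have "{a. a \<subseteq># add_mset x m} \<subseteq> {a. a \<subseteq># m} \<union> add_mset x ` {a. a \<subseteq># m}"
    by blast
  with add show ?case by (meson finite_UnI finite_imageI finite_subset)
qed simp

context cring
begin

lemma diff_diff_submultiset: "m - (m - a) = a" if "a \<subseteq># m" for a m :: "'z multiset"
  using that by (metis add_diff_cancel_right' subset_mset.add_diff_inverse)

lemma indexed_mult_closed:
  "carrier_coeff P \<Longrightarrow> carrier_coeff Q \<Longrightarrow> carrier_coeff (indexed_mult P Q)"
  unfolding carrier_coeff_def indexed_mult_def by (auto intro!: finsum_closed)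

lemma indexed_mult_comm:
  fixes P Q :: "'i multiset \<Rightarrow> 'a"
  assumes "carrier_coeff P" "carrier_coeff Q"
  shows "indexed_mult P Q = indexed_mult Q P"
proof
  fix m :: "'i multiset"
  let ?S = "{a. a \<subseteq># m}"
  have car: "P a \<in> carrier R" "Q a \<in> carrier R" for a
    using assms by (auto simp: carrier_coeff_def)
  have img: "(\<lambda>a. m - a) ` ?S = ?S"
  proof
    show "?S \<subseteq> (\<lambda>a. m - a) ` ?S"
    proof
      fix a assume "a \<in> ?S"
      then have "a = m - (m - a)" "m - a \<in> ?S"
        by (simp_all add: diff_diff_submultiset)
      then show "a \<in> (\<lambda>a. m - a) ` ?S" by blast
    qed
  qed auto
  have inj: "inj_on (\<lambda>a. m - a) ?S"
    by (rule inj_on_inverseI[where g = "\<lambda>a. m - a"]) (simp add: diff_diff_submultiset)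
  have "indexed_mult P Q m = (\<Oplus>a\<in>(\<lambda>a. m - a) ` ?S. P a \<otimes> Q (m - a))"
    unfolding img indexed_mult_def ..
  also have "\<dots> = (\<Oplus>a\<in>?S. P (m - a) \<otimes> Q (m - (m - a)))"
    using inj car by (intro finsum_reindex) auto
  also have "\<dots> = indexed_mult Q P m"
    unfolding indexed_mult_def using car
    by (intro finsum_cong') (auto simp: diff_diff_submultiset m_comm)
  finally show "indexed_mult P Q m = indexed_mult Q P m" .
qed

lemma indexed_mult_const:
  assumes "carrier_coeff P" "k \<in> carrier R"
  shows "indexed_mult P (indexed_const k) = (\<lambda>m. P m \<otimes> k)"
proof
  fix m
  have "indexed_mult P (indexed_const k) m = (\<Oplus>a\<in>{m}. P a \<otimes> k)"
    unfolding indexed_mult_def using assms finite_submultisets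
    by (intro add.finprod_mono_neutral_cong_right)
       (auto simp: carrier_coeff_def indexed_const_def Diff_eq_empty_iff_mset subset_mset.antisym)
  also have "\<dots> = P m \<otimes> k"
    using assms by (simp add: carrier_coeff_def)
  finally show "indexed_mult P (indexed_const k) m = P m \<otimes> k" .
qed

lemma indexed_mult_add:
  assumes "carrier_coeff P" "carrier_coeff Q" "carrier_coeff Q'"
  shows "indexed_mult P (indexed_padd Q Q') = indexed_padd (indexed_mult P Q) (indexed_mult P Q')"
proof
  fix m
  have car: "P a \<in> carrier R" "Q a \<in> carrier R" "Q' a \<in> carrier R" for a
    using assms by (auto simp: carrier_coeff_def)
  have "indexed_mult P (indexed_padd Q Q') m
      = (\<Oplus>a\<in>{a. a \<subseteq># m}. P a \<otimes> Q (m - a) \<oplus> P a \<otimes> Q' (m - a))"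
    unfolding indexed_mult_def indexed_padd_def using car
    by (intro finsum_cong') (auto simp: r_distr)
  also have "\<dots> = indexed_padd (indexed_mult P Q) (indexed_mult P Q') m"
    unfolding indexed_mult_def indexed_padd_def using car by (intro finsum_addf) auto
  finally show "indexed_mult P (indexed_padd Q Q') m
      = indexed_padd (indexed_mult P Q) (indexed_mult P Q') m" .
qed

lemma indexed_mult_var:
  assumes "carrier_coeff P" "carrier_coeff Q"
  shows "indexed_mult P (indexed_pmult Q i) = indexed_pmult (indexed_mult P Q) i"
proof
  fix m
  have car: "P a \<in> carrier R" "Q a \<in> carrier R" for a
    using assms by (auto simp: carrier_coeff_def)
  show "indexed_mult P (indexed_pmult Q i) m = indexed_pmult (indexed_mult P Q) i m"
  proof (cases "i \<in># m")
    case False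
    then have "i \<notin># m - a" for a by (meson in_diffD)
    then have "indexed_mult P (indexed_pmult Q i) m = (\<Oplus>a\<in>{a. a \<subseteq># m}. \<zero>)"
      unfolding indexed_mult_def indexed_pmult_def using car by (intro finsum_cong') auto
    with False show ?thesis by (simp add: indexed_pmult_def)
  next
    case True
    then obtain m' where m: "m = add_mset i m'" by (metis insert_DiffM)
    have sub: "a \<subseteq># m'" if "a \<subseteq># m" "i \<in># m - a" for a
    proof -
      have "m - a = add_mset i (m - a - {#i#})" using that(2) by (metis insert_DiffM)
      then have "m = a + add_mset i (m - a - {#i#})"
        using that(1) by (metis subset_mset.add_diff_inverse)
      then have "m' = a + (m - a - {#i#})" using m by simp
      then show ?thesis by (metis mset_subset_eq_add_left)
    qed
    have diff: "add_mset i m' - a = add_mset i (m' - a)" if "a \<subseteq># m'" for a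
      using that by (metis add_mset_add_single multiset_diff_union_assoc add.commute)
    have "indexed_mult P (indexed_pmult Q i) m = (\<Oplus>a\<in>{a. a \<subseteq># m'}. P a \<otimes> Q (m' - a))"
      unfolding indexed_mult_def
    proof (rule add.finprod_mono_neutral_cong_right)
      show "{a. a \<subseteq># m'} \<subseteq> {a. a \<subseteq># m}"
        using m by (auto intro: subset_mset.order_trans)
      show "P a \<otimes> indexed_pmult Q i (m - a) = \<zero>" if "a \<in> {a. a \<subseteq># m} - {a. a \<subseteq># m'}" for a
        using that sub car by (auto simp: indexed_pmult_def)
      show "P a \<otimes> indexed_pmult Q i (m - a) = P a \<otimes> Q (m' - a)" if "a \<in> {a. a \<subseteq># m'}" for a
        using that diff m by (auto simp: indexed_pmult_def)
    qed (use car finite_submultisets in \<open>auto simp: indexed_pmult_def\<close>)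
    then show ?thesis using m by (simp add: indexed_pmult_def indexed_mult_def)
  qed
qed

lemma cring_indexed_poly_ring:
  fixes I :: "'i set"
  shows "cring (indexed_poly_ring R I)"
proof -
  let ?A = "indexed_poly_ring R I" and ?C = "indexed_pset I (carrier R)"
  have sel: "carrier ?A = ?C" "\<zero>\<^bsub>?A\<^esub> = indexed_const \<zero>" "\<one>\<^bsub>?A\<^esub> = indexed_const \<one>"
    "add ?A = indexed_padd" "mult ?A = indexed_mult"
    by (simp_all add: indexed_poly_ring_def)
  have cc: "carrier_coeff P" if "P \<in> ?C" for P
    using indexed_pset_in_carrier[OF _ that] by simp
  have scalar: "(\<lambda>m. P m \<otimes> k) \<in> ?C" if "P \<in> ?C" "k \<in> carrier R" for P k
    using that(1)
  proof induction
    case (indexed_const k')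
    then have "(\<lambda>m :: 'i multiset. indexed_const k' m \<otimes> k) = indexed_const (k' \<otimes> k)"
      using that(2) by (auto simp: indexed_const_def)
    moreover have \<open>indexed_const (k' \<otimes> k) \<in> ?C\<close>
      using indexed_const that(2) by (intro indexed_pset.indexed_const) simp
    ultimately show ?case by simp
  next
    case (indexed_padd P Q)
    then have "(\<lambda>m. indexed_padd P Q m \<otimes> k) = indexed_padd (\<lambda>m. P m \<otimes> k) (\<lambda>m. Q m \<otimes> k)"
      using that(2) cc by (auto simp: indexed_padd_def carrier_coeff_def l_distr)
    then show ?case using indexed_pset.indexed_padd[OF indexed_padd.IH] by simp
  next
    case (indexed_pmult P i)
    then have "(\<lambda>m. indexed_pmult P i m \<otimes> k) = indexed_pmult (\<lambda>m. P m \<otimes> k) i"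
      using that(2) by (auto simp: indexed_pmult_def)
    then show ?case using indexed_pset.indexed_pmult[OF indexed_pmult.IH indexed_pmult.hyps(2)] by simp
  qed
  have closed: "indexed_mult P Q \<in> ?C" if "Q \<in> ?C" "P \<in> ?C" for P Q
    using that
    by (induction rule: indexed_pset.induct)
       (simp_all add: indexed_mult_const indexed_mult_add indexed_mult_var cc scalar indexed_pset.intros)
  have assoc: "indexed_mult (indexed_mult P Q) S = indexed_mult P (indexed_mult Q S)"
    if "S \<in> ?C" "P \<in> ?C" "Q \<in> ?C" for P Q S
    using that
  proof (induction rule: indexed_pset.induct)
    case (indexed_const k)
    have PQ: "P a \<in> carrier R" "Q a \<in> carrier R" for a
      using indexed_const cc by (auto simp: carrier_coeff_def)
    have "indexed_mult P Q m \<otimes> k = indexed_mult P (\<lambda>m. Q m \<otimes> k) m" for m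
    proof -
      have "indexed_mult P Q m \<otimes> k = (\<Oplus>a\<in>{a. a \<subseteq># m}. P a \<otimes> Q (m - a) \<otimes> k)"
        unfolding indexed_mult_def using PQ indexed_const finite_submultisets
        by (intro finsum_ldistr) auto
      also have "\<dots> = indexed_mult P (\<lambda>m. Q m \<otimes> k) m"
        unfolding indexed_mult_def using PQ indexed_const
        by (intro finsum_cong') (auto simp: m_assoc)
      finally show ?thesis .
    qed
    then show ?case
      using indexed_const by (simp add: indexed_mult_const indexed_mult_closed cc)
  qed (simp_all add: indexed_mult_add indexed_mult_var indexed_mult_closed cc)
  have one: "indexed_const \<one> \<in> ?C" and zero: "indexed_const \<zero> \<in> ?C"
    by (simp_all add: indexed_pset.indexed_const)
  have r_one: "indexed_mult P (indexed_const \<one>) = P" if "P \<in> ?C" for P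
    using cc[OF that] by (auto simp: indexed_mult_const carrier_coeff_def)
  show ?thesis
  proof (rule cringI)
    show "abelian_group ?A"
    proof (rule abelian_groupI; unfold sel)
      fix P assume P: "P \<in> ?C"
      then have "(\<lambda>m. P m \<otimes> (\<ominus> \<one>)) \<in> ?C" by (intro scalar) auto
      moreover have "indexed_padd (\<lambda>m. P m \<otimes> (\<ominus> \<one>)) P = indexed_const \<zero>"
        using cc[OF P] by (auto simp: indexed_padd_def carrier_coeff_def indexed_zero_def r_minus l_neg)
      ultimately show "\<exists>Q\<in>?C. indexed_padd Q P = indexed_const \<zero>" by blast
    next
      fix P Q assume *: "P \<in> ?C" "Q \<in> ?C"
      show "indexed_padd P Q \<in> ?C" using * by (rule indexed_pset.indexed_padd)
      show "indexed_padd P Q = indexed_padd Q P"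
        using * cc by (auto simp: indexed_padd_def carrier_coeff_def a_comm)
      fix S assume "S \<in> ?C"
      with * show "indexed_padd (indexed_padd P Q) S = indexed_padd P (indexed_padd Q S)"
        using cc by (auto simp: indexed_padd_def carrier_coeff_def a_assoc)
    qed (use zero cc indexed_padd_zero in auto)
    show "comm_monoid ?A"
    proof (rule comm_monoidI; unfold sel)
      fix P Q S assume *: "P \<in> ?C" "Q \<in> ?C" "S \<in> ?C"
      show "indexed_mult P Q \<in> ?C" using * closed by blast
      show "indexed_mult (indexed_mult P Q) S = indexed_mult P (indexed_mult Q S)"
        using * assoc by blast
    next
      fix P Q assume *: "P \<in> ?C" "Q \<in> ?C"
      show "indexed_mult P Q = indexed_mult Q P"
        using * cc indexed_mult_comm by blast
      show "indexed_mult (indexed_const \<one>) P = P"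
        using * cc one r_one indexed_mult_comm[of "indexed_const \<one>" P] by simp
    qed (use one in simp)
    show "(P \<oplus>\<^bsub>?A\<^esub> Q) \<otimes>\<^bsub>?A\<^esub> S = P \<otimes>\<^bsub>?A\<^esub> S \<oplus>\<^bsub>?A\<^esub> Q \<otimes>\<^bsub>?A\<^esub> S"
      if "P \<in> carrier ?A" "Q \<in> carrier ?A" "S \<in> carrier ?A" for P Q S
    proof -
      have PQS: "carrier_coeff P" "carrier_coeff Q" "carrier_coeff S"
        using that cc unfolding sel by auto
      show ?thesis
        unfolding sel
        using PQS indexed_mult_add[of S P Q] indexed_mult_comm[of S]
          indexed_padd_in_carrier[of P Q] by simp
    qed
  qed
qed

end

end

theory Submission
  imports Defs
begin

text \<open>
  For an orthogonal \<open>N \<times> N\<close> matrix \<open>U\<close> the Gaussian vectors \<open>g\<close> and \<open>U\<^sup>T g\<close> have the same law, so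
  cotype \<open>p\<^sub>2\<close> applied to \<open>\<Sum>\<^sub>i g\<^sub>i (U x)\<^sub>i\<close> and type \<open>p\<^sub>1\<close> applied to \<open>\<Sum>\<^sub>j (U\<^sup>T g)\<^sub>j x\<^sub>j\<close> bound the
  \<open>p\<^sub>2\<close>-norm of \<open>U x\<close> by a constant times the \<open>p\<^sub>1\<close>-norm of \<open>x\<close>. In a linear isometric
  representation of the Heisenberg group over the field with \<open>q\<close> elements, let \<open>P\<^sub>A\<close>, \<open>P\<^sub>B\<close>, \<open>P\<^sub>Z\<close> be
  the averages over two generating root subgroups and the centre. The above with \<open>N = q\<^sup>2\<close> and the
  centred point-line incidence matrix of the affine plane yields
  \<open>\<parallel>P\<^sub>A P\<^sub>B (1 - P\<^sub>Z)\<parallel> = O(q powr (2 (1/p\<^sub>1 - 1/p\<^sub>2) - 1/2))\<close>, which tends to \<open>0\<close>.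

  The Steinberg group is generated by the root subgroups of \<open>x\<^sub>i\<^sub>,\<^sub>i\<^sub>+\<^sub>1(\<tau>)\<close> (indices cyclic) with
  \<open>\<tau>\<close> one of \<open>1, t\<^sub>1, \<dots>, t\<^sub>m\<close>; their number does not depend on \<open>q\<close>, and any two of them commute or
  generate a Heisenberg group. For an affine action the averages \<open>P\<^sub>i\<close> over these subgroups
  therefore almost commute, relative to the displacement \<open>max \<parallel>P\<^sub>i x - x\<parallel>\<close>, so that replacing \<open>x\<close>
  by the mean of all \<open>P\<^sub>i x\<close> contracts the displacement. The iteration converges to a fixed point.
\<close>

section \<open>Rotation invariance of the Gaussian measure\<close>

abbreviation lborel_pi :: "nat \<Rightarrow> (nat \<Rightarrow> real) measure" where
  "lborel_pi N \<equiv> PiM {..<N} (\<lambda>_. lborel)"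

definition gaussian_pi :: "nat \<Rightarrow> (nat \<Rightarrow> real) measure" where
  "gaussian_pi N = PiM {..<N} (\<lambda>_. density lborel std_normal_density)"

lemma product_sigma_finite_lborel: "product_sigma_finite (\<lambda>_::'i. lborel :: real measure)"
  by standard

lemma prob_space_std_normal: "prob_space (density lborel std_normal_density)"
  using prob_space_normal_density[of 1 0] by simp

lemma sigma_finite_lborel_pi: "sigma_finite_measure (lborel_pi N)"
  using product_sigma_finite.sigma_finite[OF product_sigma_finite_lborel] by blast

lemma sets_gaussian_pi: "sets (gaussian_pi N) = sets (lborel_pi N)"
  unfolding gaussian_pi_def by (intro sets_PiM_cong) auto

lemma distr_lborel_pi_translate:
  "distr (lborel_pi N) (lborel_pi N) (\<lambda>x. \<lambda>i\<in>{..<N}. x i + a i) = lborel_pi N"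
proof (rule product_sigma_finite.PiM_eqI[OF product_sigma_finite_lborel])
  interpret product_sigma_finite "\<lambda>_::nat. lborel :: real measure"
    by (rule product_sigma_finite_lborel)
  fix A :: "nat \<Rightarrow> real set" assume A: "\<And>i. i \<in> {..<N} \<Longrightarrow> A i \<in> sets lborel"
  have meas: "(\<lambda>x. \<lambda>i\<in>{..<N}. x i + a i) \<in> measurable (lborel_pi N) (lborel_pi N)"
    by measurable
  have pre: "(\<lambda>x. x + a i) -` A i \<in> sets lborel" if "i < N" for i
    using measurable_sets[of "\<lambda>x. x + a i" lborel borel "A i"] A[of i] that by simp
  have "emeasure (distr (lborel_pi N) (lborel_pi N) (\<lambda>x. \<lambda>i\<in>{..<N}. x i + a i)) (Pi\<^sub>E {..<N} A)
      = emeasure (lborel_pi N) ((\<lambda>x. \<lambda>i\<in>{..<N}. x i + a i) -` Pi\<^sub>E {..<N} A \<inter> space (lborel_pi N))"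
    using meas A by (intro emeasure_distr) (auto intro!: sets_PiM_I_finite)
  also have "(\<lambda>x. \<lambda>i\<in>{..<N}. x i + a i) -` Pi\<^sub>E {..<N} A \<inter> space (lborel_pi N)
      = Pi\<^sub>E {..<N} (\<lambda>i. (\<lambda>x. x + a i) -` A i)"
    by (auto simp: space_PiM PiE_iff)
  also have "emeasure (lborel_pi N) \<dots> = (\<Prod>i<N. emeasure lborel ((\<lambda>x. x + a i) -` A i))"
    using pre by (intro emeasure_PiM) auto
  also have "\<dots> = (\<Prod>i<N. emeasure lborel (A i))"
  proof (intro prod.cong HOL.refl)
    fix i assume "i \<in> {..<N}"
    have "(\<lambda>x. x + a i) = (+) (a i)"
      by (rule ext) (rule add.commute)
    then have "emeasure lborel (A i) = emeasure (distr lborel borel (\<lambda>x. x + a i)) (A i)"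
      by (simp only: lborel_distr_plus)
    also have "\<dots> = emeasure lborel ((\<lambda>x. x + a i) -` A i)"
      using A[of i] \<open>i \<in> {..<N}\<close> by (subst emeasure_distr) auto
    finally show "emeasure lborel ((\<lambda>x. x + a i) -` A i) = emeasure lborel (A i)" by simp
  qed
  finally show "emeasure (distr (lborel_pi N) (lborel_pi N) (\<lambda>x. \<lambda>i\<in>{..<N}. x i + a i)) (Pi\<^sub>E {..<N} A)
      = (\<Prod>i<N. emeasure lborel (A i))" .
qed auto

text \<open>By Fubini: for a fixed first coordinate the second one is merely translated. Only
  measurability of \<open>f\<close> enters, so no determinant has to be computed.\<close>

lemma distr_shear_snd:
  assumes f [measurable]: "\<And>i. (\<lambda>x. f x i) \<in> borel_measurable (lborel_pi N)"
  defines "S \<equiv> \<lambda>(x, y). (x, \<lambda>i\<in>{..<N}. y i + f x i)"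
  shows "S \<in> measurable (lborel_pi N \<Otimes>\<^sub>M lborel_pi N) (lborel_pi N \<Otimes>\<^sub>M lborel_pi N)"
    and "distr (lborel_pi N \<Otimes>\<^sub>M lborel_pi N) (lborel_pi N \<Otimes>\<^sub>M lborel_pi N) S
      = lborel_pi N \<Otimes>\<^sub>M lborel_pi N"
proof -
  let ?L = "lborel_pi N"
  interpret sigma_finite_measure ?L by (rule sigma_finite_lborel_pi)
  show S [measurable]: "S \<in> measurable (?L \<Otimes>\<^sub>M ?L) (?L \<Otimes>\<^sub>M ?L)"
    unfolding S_def by measurable
  show "distr (?L \<Otimes>\<^sub>M ?L) (?L \<Otimes>\<^sub>M ?L) S = ?L \<Otimes>\<^sub>M ?L"
  proof (rule measure_eqI)
    fix A assume "A \<in> sets (distr (?L \<Otimes>\<^sub>M ?L) (?L \<Otimes>\<^sub>M ?L) S)"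
    then have A [measurable]: "A \<in> sets (?L \<Otimes>\<^sub>M ?L)" by simp
    have "emeasure (distr (?L \<Otimes>\<^sub>M ?L) (?L \<Otimes>\<^sub>M ?L) S) A
        = (\<integral>\<^sup>+p. indicator A p \<partial>distr (?L \<Otimes>\<^sub>M ?L) (?L \<Otimes>\<^sub>M ?L) S)"
      by simp
    also have "\<dots> = (\<integral>\<^sup>+p. indicator A (S p) \<partial>(?L \<Otimes>\<^sub>M ?L))"
      by (rule nn_integral_distr) measurable
    also have "\<dots> = (\<integral>\<^sup>+x. \<integral>\<^sup>+y. indicator A (S (x, y)) \<partial>?L \<partial>?L)"
      by (rule nn_integral_fst[symmetric]) measurable
    also have "\<dots> = (\<integral>\<^sup>+x. \<integral>\<^sup>+y. indicator A (x, y) \<partial>?L \<partial>?L)"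
    proof (rule nn_integral_cong)
      fix x assume [measurable]: "x \<in> space ?L"
      have "(\<integral>\<^sup>+y. indicator A (S (x, y)) \<partial>?L)
          = (\<integral>\<^sup>+y. indicator A (x, y) \<partial>distr ?L ?L (\<lambda>y. \<lambda>i\<in>{..<N}. y i + f x i))"
        unfolding S_def by (subst nn_integral_distr) auto
      then show "(\<integral>\<^sup>+y. indicator A (S (x, y)) \<partial>?L) = (\<integral>\<^sup>+y. indicator A (x, y) \<partial>?L)"
        by (simp add: distr_lborel_pi_translate)
    qed
    also have "\<dots> = (\<integral>\<^sup>+p. indicator A p \<partial>(?L \<Otimes>\<^sub>M ?L))"
      by (rule nn_integral_fst) measurable
    finally show "emeasure (distr (?L \<Otimes>\<^sub>M ?L) (?L \<Otimes>\<^sub>M ?L) S) A = emeasure (?L \<Otimes>\<^sub>M ?L) A"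
      by simp
  qed simp
qed

text \<open>Conjugation of the previous shear by the coordinate swap, which preserves the product
  measure.\<close>

lemma distr_shear_fst:
  assumes f [measurable]: "\<And>i. (\<lambda>y. f y i) \<in> borel_measurable (lborel_pi N)"
  defines "S \<equiv> \<lambda>(x, y). (\<lambda>i\<in>{..<N}. x i + f y i, y)"
  shows "S \<in> measurable (lborel_pi N \<Otimes>\<^sub>M lborel_pi N) (lborel_pi N \<Otimes>\<^sub>M lborel_pi N)"
    and "distr (lborel_pi N \<Otimes>\<^sub>M lborel_pi N) (lborel_pi N \<Otimes>\<^sub>M lborel_pi N) S
      = lborel_pi N \<Otimes>\<^sub>M lborel_pi N"
proof -
  let ?L = "lborel_pi N" and ?T = "\<lambda>(x, y). (x, \<lambda>i\<in>{..<N}. y i + f x i)"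
  interpret L: sigma_finite_measure ?L by (rule sigma_finite_lborel_pi)
  interpret pair_sigma_finite ?L ?L ..
  have swap_eq: "prod.swap = (\<lambda>(x, y). (y, x))"
    by auto
  note T = distr_shear_snd[where f = f and N = N, OF f]
  have swap: "distr (?L \<Otimes>\<^sub>M ?L) (?L \<Otimes>\<^sub>M ?L) prod.swap = ?L \<Otimes>\<^sub>M ?L"
    unfolding swap_eq by (rule HOL.sym) (rule distr_pair_swap)
  have sm [measurable]: "prod.swap \<in> measurable (?L \<Otimes>\<^sub>M ?L) (?L \<Otimes>\<^sub>M ?L)"
    using measurable_pair_swap' unfolding swap_eq .
  note [measurable] = T(1)
  have S: "S = prod.swap \<circ> (?T \<circ> prod.swap)"
    unfolding S_def by auto
  show "S \<in> measurable (?L \<Otimes>\<^sub>M ?L) (?L \<Otimes>\<^sub>M ?L)"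
    unfolding S by (intro measurable_comp[OF _ sm] measurable_comp[OF sm] T)
  have "distr (?L \<Otimes>\<^sub>M ?L) (?L \<Otimes>\<^sub>M ?L) S = distr (distr (?L \<Otimes>\<^sub>M ?L) (?L \<Otimes>\<^sub>M ?L) (?T \<circ> prod.swap)) (?L \<Otimes>\<^sub>M ?L) prod.swap"
    unfolding S by (rule distr_distr[OF sm measurable_comp[OF sm T(1)], symmetric])
  also have "distr (?L \<Otimes>\<^sub>M ?L) (?L \<Otimes>\<^sub>M ?L) (?T \<circ> prod.swap) = distr (distr (?L \<Otimes>\<^sub>M ?L) (?L \<Otimes>\<^sub>M ?L) prod.swap) (?L \<Otimes>\<^sub>M ?L) ?T"
    by (rule distr_distr[OF T(1) sm, symmetric])
  finally show "distr (?L \<Otimes>\<^sub>M ?L) (?L \<Otimes>\<^sub>M ?L) S = (?L \<Otimes>\<^sub>M ?L)"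
    by (simp only: swap T(2))
qed

section \<open>The standard Gaussian measure as a density\<close>

lemma prod_std_normal_density:
  "(\<Prod>i<N. std_normal_density (x i)) = (1 / sqrt (2 * pi)) ^ N * exp (- (\<Sum>i<N. (x i)\<^sup>2) / 2)"
proof -
  have "exp (- (\<Sum>i<N. (x i)\<^sup>2) / 2) = (\<Prod>i<N. exp (- (x i)\<^sup>2 / 2))"
    by (simp add: exp_sum[symmetric] sum_negf sum_divide_distrib)
  then show ?thesis
    by (simp only: std_normal_density_def prod.distrib prod_constant card_lessThan)
qed

text \<open>Both measures agree on boxes, where the integral of the product density
  factorises.\<close>

lemma gaussian_pi_density:
  "gaussian_pi N = density (lborel_pi N) (\<lambda>x. \<Prod>i<N. ennreal (std_normal_density (x i)))"
  unfolding gaussian_pi_def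
proof (rule product_sigma_finite.PiM_eqI[symmetric])
  interpret std: prob_space "density lborel std_normal_density" by (rule prob_space_std_normal)
  show "product_sigma_finite (\<lambda>_::nat. density lborel std_normal_density)" ..
  interpret product_sigma_finite "\<lambda>_::nat. lborel :: real measure"
    by (rule product_sigma_finite_lborel)
  show "sets (density (lborel_pi N) (\<lambda>x. \<Prod>i<N. ennreal (std_normal_density (x i))))
      = sets (PiM {..<N} (\<lambda>_. density lborel std_normal_density))"
    using sets_gaussian_pi[of N] by (simp add: gaussian_pi_def)
  fix A :: "nat \<Rightarrow> real set"
  assume "\<And>i. i \<in> {..<N} \<Longrightarrow> A i \<in> sets (density lborel std_normal_density)"
  then have A [measurable]: "i < N \<Longrightarrow> A i \<in> sets lborel" for i by auto
  have "emeasure (density (lborel_pi N) (\<lambda>x. \<Prod>i<N. ennreal (std_normal_density (x i)))) (Pi\<^sub>E {..<N} A)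
      = (\<integral>\<^sup>+x. (\<Prod>i<N. ennreal (std_normal_density (x i))) * indicator (Pi\<^sub>E {..<N} A) x \<partial>lborel_pi N)"
    using A by (intro emeasure_density) (auto intro!: sets_PiM_I_finite)
  also have "\<dots> = (\<integral>\<^sup>+x. (\<Prod>i<N. ennreal (std_normal_density (x i)) * indicator (A i) (x i)) \<partial>lborel_pi N)"
  proof (rule nn_integral_cong)
    fix x assume "x \<in> space (lborel_pi N)"
    then have "indicator (Pi\<^sub>E {..<N} A) x = (\<Prod>i<N. indicator (A i) (x i) :: ennreal)"
      by (auto simp: indicator_def space_PiM PiE_iff prod_zero_iff)
    then show "(\<Prod>i<N. ennreal (std_normal_density (x i))) * indicator (Pi\<^sub>E {..<N} A) x
        = (\<Prod>i<N. ennreal (std_normal_density (x i)) * indicator (A i) (x i))"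
      by (simp add: prod.distrib)
  qed
  also have "\<dots> = (\<Prod>i<N. \<integral>\<^sup>+x. ennreal (std_normal_density x) * indicator (A i) x \<partial>lborel)"
    using A by (intro product_nn_integral_prod) auto
  also have "\<dots> = (\<Prod>i<N. emeasure (density lborel std_normal_density) (A i))"
    using A by (intro prod.cong HOL.refl emeasure_density[symmetric]) auto
  finally show "emeasure (density (lborel_pi N) (\<lambda>x. \<Prod>i<N. ennreal (std_normal_density (x i)))) (Pi\<^sub>E {..<N} A)
      = (\<Prod>i<N. emeasure (density lborel std_normal_density) (A i))" .
qed simp

section \<open>Orthogonal matrices and their action on Gaussian vectors\<close>

text \<open>The restriction to \<open>{..<N}\<close> keeps the values among the extensional
  functions on which \<open>PiM\<close> lives.\<close>

definition mat_mul_vec :: "nat \<Rightarrow> (nat \<Rightarrow> nat \<Rightarrow> real) \<Rightarrow> (nat \<Rightarrow> real) \<Rightarrow> nat \<Rightarrow> real" where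
  "mat_mul_vec N U x = (\<lambda>i\<in>{..<N}. \<Sum>j<N. U i j * x j)"

text \<open>Orthonormality is demanded of rows and of columns, so that transposition is immediate; a
  general index set admits matrices indexed by pairs of residues.\<close>

definition orthogonal_mat_on :: "'i set \<Rightarrow> ('i \<Rightarrow> 'i \<Rightarrow> real) \<Rightarrow> bool" where
  "orthogonal_mat_on I U \<longleftrightarrow>
     (\<forall>i\<in>I. \<forall>k\<in>I. (\<Sum>j\<in>I. U i j * U k j) = of_bool (i = k)) \<and>
     (\<forall>i\<in>I. \<forall>k\<in>I. (\<Sum>j\<in>I. U j i * U j k) = of_bool (i = k))"

lemma orthogonal_mat_on_transpose:
  "orthogonal_mat_on I U \<Longrightarrow> orthogonal_mat_on I (\<lambda>i j. U j i)"
  by (simp add: orthogonal_mat_on_def)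

lemma mat_mul_vec_transpose:
  assumes "orthogonal_mat_on {..<N} U" "i < N"
  shows "mat_mul_vec N U (mat_mul_vec N (\<lambda>i j. U j i) x) i = x i"
proof -
  have "mat_mul_vec N U (mat_mul_vec N (\<lambda>i j. U j i) x) i = (\<Sum>j<N. \<Sum>k<N. U i j * U k j * x k)"
    using assms(2) by (simp add: mat_mul_vec_def sum_distrib_left mult.assoc)
  also have "\<dots> = (\<Sum>k<N. (\<Sum>j<N. U i j * U k j) * x k)"
    by (subst sum.swap) (simp add: sum_distrib_right)
  also have "\<dots> = (\<Sum>k<N. if i = k then x k else 0)"
    using assms by (intro sum.cong) (auto simp: orthogonal_mat_on_def)
  finally show ?thesis using assms(2) by simp
qed

lemma mat_mul_vec_norm:
  assumes "orthogonal_mat_on {..<N} U"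
  shows "(\<Sum>i<N. (mat_mul_vec N U x i)\<^sup>2) = (\<Sum>i<N. (x i)\<^sup>2)"
proof -
  have "(\<Sum>i<N. (mat_mul_vec N U x i)\<^sup>2) = (\<Sum>i<N. \<Sum>j<N. U i j * (x j * mat_mul_vec N U x i))"
    by (simp add: mat_mul_vec_def power2_eq_square sum_distrib_right mult.assoc)
  also have "\<dots> = (\<Sum>j<N. x j * mat_mul_vec N (\<lambda>i j. U j i) (mat_mul_vec N U x) j)"
    by (subst sum.swap) (simp add: mat_mul_vec_def[of N "\<lambda>i j. U j i"] sum_distrib_left mult.left_commute)
  also have "\<dots> = (\<Sum>j<N. x j * x j)"
    using mat_mul_vec_transpose[OF orthogonal_mat_on_transpose[OF assms]] by (intro sum.cong) auto
  finally show ?thesis by (simp add: power2_eq_square)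
qed

lemma mat_mul_vec_measurable [measurable]:
  "mat_mul_vec N U \<in> measurable (lborel_pi N) (lborel_pi N)"
  unfolding mat_mul_vec_def by measurable

lemma mat_mul_vec_component_measurable:
  "(\<lambda>x. mat_mul_vec N U x i) \<in> borel_measurable (lborel_pi N)"
  by (cases "i < N") (simp_all add: mat_mul_vec_def)

lemma mat_mul_vec_cong: "(\<And>j. j < N \<Longrightarrow> x j = y j) \<Longrightarrow> mat_mul_vec N U x = mat_mul_vec N U y"
  by (simp add: mat_mul_vec_def cong: restrict_cong)

lemma mat_mul_vec_diff:
  "i < N \<Longrightarrow> mat_mul_vec N U (\<lambda>j. x j - y j) i = mat_mul_vec N U x i - mat_mul_vec N U y i"
  by (simp add: mat_mul_vec_def right_diff_distrib sum_subtractf)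

text \<open>On pairs of vectors the map (x, y) -> (-U^T y, U x) is a composite of three shears,
  hence preserves Lebesgue measure; it also preserves the joint Gaussian density. Comparing second
  marginals gives the law of U x.\<close>

lemma distr_gaussian_pi_orthogonal:
  assumes U: "orthogonal_mat_on {..<N} U"
  shows "distr (gaussian_pi N) (gaussian_pi N) (mat_mul_vec N U) = gaussian_pi N"
proof -
  let ?L = "lborel_pi N" and ?G = "gaussian_pi N" and ?V = "\<lambda>i j. U j i"
  let ?LL = "?L \<Otimes>\<^sub>M ?L"
  define \<gamma> where "\<gamma> x = (\<Prod>i<N. ennreal (std_normal_density (x i)))" for x :: "nat \<Rightarrow> real"
  define S where "S = (\<lambda>(x, y). (\<lambda>i\<in>{..<N}. x i + - mat_mul_vec N ?V y i, y))"
  define S' where "S' = (\<lambda>(x, y). (x, \<lambda>i\<in>{..<N}. y i + mat_mul_vec N U x i))"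
  define R where "R = S \<circ> (S' \<circ> S)"
  note V = orthogonal_mat_on_transpose[OF U]
  have S: "S \<in> measurable ?LL ?LL" "distr ?LL ?LL S = ?LL"
    unfolding S_def by (rule distr_shear_fst, intro borel_measurable_uminus mat_mul_vec_component_measurable)+
  have S': "S' \<in> measurable ?LL ?LL" "distr ?LL ?LL S' = ?LL"
    unfolding S'_def by (rule distr_shear_snd, rule mat_mul_vec_component_measurable)+
  have R [measurable]: "R \<in> measurable ?LL ?LL"
    unfolding R_def by (intro measurable_comp[OF _ S(1)] measurable_comp[OF S(1)] S')
  have "distr ?LL ?LL R = distr (distr ?LL ?LL (S' \<circ> S)) ?LL S"
    unfolding R_def by (rule distr_distr[OF S(1) measurable_comp[OF S(1) S'(1)], symmetric])
  also have "distr ?LL ?LL (S' \<circ> S) = distr (distr ?LL ?LL S) ?LL S'"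
    by (rule distr_distr[OF S'(1) S(1), symmetric])
  finally have distr_R: "distr ?LL ?LL R = ?LL"
    by (simp only: S(2) S'(2))
  \<comment> \<open>The first two shears turn y into U x because U U^T = 1; the last one turns x -
    U^T y into -U^T y because U^T U = 1.\<close>
  have R_eq: "R (x, y) = (\<lambda>i\<in>{..<N}. - mat_mul_vec N ?V y i, mat_mul_vec N U x)" for x y
  proof -
    let ?y = "\<lambda>i\<in>{..<N}. y i + mat_mul_vec N U (\<lambda>i\<in>{..<N}. x i + - mat_mul_vec N ?V y i) i"
    have "mat_mul_vec N U (\<lambda>i\<in>{..<N}. x i + - mat_mul_vec N ?V y i)
        = mat_mul_vec N U (\<lambda>i. x i - mat_mul_vec N ?V y i)"
      by (rule mat_mul_vec_cong) simp
    then have y: "?y i = mat_mul_vec N U x i" if "i < N" for i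
      using that mat_mul_vec_transpose[OF U that] by (simp add: mat_mul_vec_diff)
    then have "?y = mat_mul_vec N U x"
      by (auto simp: mat_mul_vec_def)
    then show ?thesis
      unfolding R_def S_def S'_def using mat_mul_vec_transpose[OF V] by (auto cong: restrict_cong)
  qed
  define \<Gamma> where "\<Gamma> = (\<lambda>(x, y). \<gamma> x * \<gamma> y)"
  have [measurable]: "\<gamma> \<in> borel_measurable ?L" "\<Gamma> \<in> borel_measurable ?LL"
    unfolding \<gamma>_def \<Gamma>_def by measurable
  have \<gamma>: "\<gamma> x = ennreal ((1 / sqrt (2 * pi)) ^ N * exp (- (\<Sum>i<N. (x i)\<^sup>2) / 2))" for x
    unfolding \<gamma>_def by (subst prod_ennreal) (auto simp: prod_std_normal_density)
  have "\<gamma> (\<lambda>i\<in>{..<N}. - mat_mul_vec N ?V y i) = \<gamma> y" "\<gamma> (mat_mul_vec N U x) = \<gamma> x" for x y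
    by (simp_all add: \<gamma> mat_mul_vec_norm[OF U] mat_mul_vec_norm[OF V])
  then have \<Gamma>R: "\<Gamma> (R p) = \<Gamma> p" for p
    by (cases p) (simp add: \<Gamma>_def R_eq mult.commute)
  interpret G: prob_space ?G
    unfolding gaussian_pi_def by (intro prob_space_PiM prob_space_std_normal)
  interpret pair_sigma_finite ?G ?G ..
  interpret L: sigma_finite_measure ?L by (rule sigma_finite_lborel_pi)
  have G: "?G = density ?L \<gamma>"
    by (simp add: gaussian_pi_density \<gamma>_def[abs_def])
  have GG: "?G \<Otimes>\<^sub>M ?G = density ?LL \<Gamma>"
    unfolding G \<Gamma>_def using G.sigma_finite_measure_axioms L.sigma_finite_measure_axioms
    by (intro pair_measure_density) (auto simp: G)
  have sets_GG: "sets (?G \<Otimes>\<^sub>M ?G) = sets ?LL"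
    by (simp only: GG sets_density)
  have R_GG [measurable]: "R \<in> measurable (?G \<Otimes>\<^sub>M ?G) (?G \<Otimes>\<^sub>M ?G)"
    using R measurable_cong_sets[OF sets_GG sets_GG] by blast
  have [measurable]: "mat_mul_vec N U \<in> measurable ?G ?G"
    using mat_mul_vec_measurable measurable_cong_sets[OF sets_gaussian_pi sets_gaussian_pi] by blast
  have "distr (?G \<Otimes>\<^sub>M ?G) (?G \<Otimes>\<^sub>M ?G) R = distr (density ?LL (\<lambda>p. \<Gamma> (R p))) ?LL R"
    by (rule distr_cong) (simp_all only: GG \<Gamma>R sets_density)
  also have "\<dots> = density (distr ?LL ?LL R) \<Gamma>"
    by (rule density_distr[symmetric]) measurable
  finally have GG_R: "distr (?G \<Otimes>\<^sub>M ?G) (?G \<Otimes>\<^sub>M ?G) R = ?G \<Otimes>\<^sub>M ?G"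
    by (simp add: distr_R GG)
  have snd_GG: "distr (?G \<Otimes>\<^sub>M ?G) ?G snd = ?G"
  proof -
    have "distr (?G \<Otimes>\<^sub>M ?G) ?G snd = distr (distr (?G \<Otimes>\<^sub>M ?G) (?G \<Otimes>\<^sub>M ?G) (\<lambda>(x, y). (y, x))) ?G fst"
      by (subst distr_distr) (auto simp: comp_def case_prod_beta intro!: distr_cong)
    then show ?thesis
      by (simp only: distr_pair_swap[symmetric] G.distr_pair_fst)
  qed
  have fst_GG: "distr (?G \<Otimes>\<^sub>M ?G) ?G fst = ?G"
    by (rule G.distr_pair_fst)
  \<comment> \<open>The second component of \<open>R (x, y)\<close> depends on \<open>x\<close>
    only, so its law is that of \<open>mat_mul_vec N U\<close> under \<open>?G\<close>; by
    invariance of the pair measure under \<open>R\<close> it is also the law of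
    \<open>snd\<close>.\<close>
  have "distr ?G ?G (mat_mul_vec N U) = distr (distr (?G \<Otimes>\<^sub>M ?G) ?G fst) ?G (mat_mul_vec N U)"
    by (simp add: fst_GG)
  also have "\<dots> = distr (?G \<Otimes>\<^sub>M ?G) ?G (mat_mul_vec N U \<circ> fst)"
    by (rule distr_distr) measurable
  also have "mat_mul_vec N U \<circ> fst = snd \<circ> R"
    by (auto simp: R_eq)
  also have "distr (?G \<Otimes>\<^sub>M ?G) ?G (snd \<circ> R) = distr (distr (?G \<Otimes>\<^sub>M ?G) (?G \<Otimes>\<^sub>M ?G) R) ?G snd"
    by (rule distr_distr[symmetric]) measurable
  finally show ?thesis
    by (simp add: GG_R snd_GG)
qed

text \<open>One equation of joint laws encodes both requirements: its marginals are standard normal,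
  and a product law means independence.\<close>

lemma iid_std_gaussians_of_distr:
  assumes M: "prob_space M" and g: "\<And>i. i < N \<Longrightarrow> g i \<in> borel_measurable M"
    and distr: "distr M (gaussian_pi N) (\<lambda>\<omega>. \<lambda>i\<in>{..<N}. g i \<omega>) = gaussian_pi N"
  shows "iid_std_gaussians M N g"
proof -
  interpret prob_space M by fact
  let ?n = "density lborel std_normal_density"
  have meas: "(\<lambda>\<omega>. \<lambda>i\<in>{..<N}. g i \<omega>) \<in> measurable M (gaussian_pi N)"
    unfolding gaussian_pi_def using g by (intro measurable_restrict) auto
  have d: "distr M borel (g i) = ?n" if i: "i < N" for i
  proof -
    have "distr M ?n (g i) = distr M ?n ((\<lambda>x. x i) \<circ> (\<lambda>\<omega>. \<lambda>i\<in>{..<N}. g i \<omega>))"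
      using i by (intro distr_cong) auto
    also have "\<dots> = distr (distr M (gaussian_pi N) (\<lambda>\<omega>. \<lambda>i\<in>{..<N}. g i \<omega>)) ?n (\<lambda>x. x i)"
      using i by (intro distr_distr[symmetric] meas) (auto simp: gaussian_pi_def)
    also have "\<dots> = ?n"
      unfolding distr unfolding gaussian_pi_def using i
      by (intro distr_PiM_component prob_space_std_normal) auto
    finally show ?thesis
      by (simp cong: distr_cong)
  qed
  have "distributed M lborel (g i) std_normal_density" if "i < N" for i
    using d[OF that] g[OF that] by (auto simp: distributed_def cong: distr_cong)
  \<comment> \<open>The product criterion for independence is stated for nonempty index sets; for
    \<open>N = 0\<close> independence is vacuous.\<close>
  moreover have "indep_vars (\<lambda>_. borel) g {..<N}"
  proof (cases "N = 0")
    case False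
    have "distr M (PiM {..<N} (\<lambda>_. borel)) (\<lambda>\<omega>. \<lambda>i\<in>{..<N}. g i \<omega>)
        = distr M (gaussian_pi N) (\<lambda>\<omega>. \<lambda>i\<in>{..<N}. g i \<omega>)"
      by (intro distr_cong) (auto simp: gaussian_pi_def intro!: sets_PiM_cong)
    also have "\<dots> = PiM {..<N} (\<lambda>i. distr M borel (g i))"
      unfolding distr unfolding gaussian_pi_def by (intro PiM_cong) (auto simp: d)
    finally show ?thesis
      using False g by (subst indep_vars_iff_distr_eq_PiM') auto
  qed (simp add: indep_vars_def indep_sets_def)
  ultimately show ?thesis
    by (simp add: iid_std_gaussians_def)
qed

section \<open>Orthogonal matrices and type and cotype\<close>

text \<open>\<open>K\<close> is uniform in the dimension \<open>N\<close>; this is what later allows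
  \<open>q\<close> to grow.\<close>

definition orthogonal_bound :: "'x::real_normed_vector itself \<Rightarrow> real \<Rightarrow> real \<Rightarrow> real \<Rightarrow> bool" where
  "orthogonal_bound tx p1 p2 K \<longleftrightarrow>
     (\<forall>N U (x :: nat \<Rightarrow> 'x). orthogonal_mat_on {..<N} U \<longrightarrow>
        (\<Sum>i<N. norm (\<Sum>j<N. U i j *\<^sub>R x j) powr p2) powr (1 / p2)
          \<le> K * (\<Sum>j<N. norm (x j) powr p1) powr (1 / p1))"

lemma type_cotype_orthogonal_bound:
  assumes "gaussian_type TYPE('x::complex_banach) p1" "gaussian_cotype TYPE('x) p2"
  obtains K where "K \<ge> 0" "orthogonal_bound TYPE('x) p1 p2 K"
proof -
  obtain T where T: "\<And>k (x :: nat \<Rightarrow> 'x) (M :: (nat \<Rightarrow> real) measure) g. prob_space M \<Longrightarrow>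
      iid_std_gaussians M k g \<Longrightarrow> gaussian_L2_norm M k g x \<le> T * (\<Sum>i<k. norm (x i) powr p1) powr (1 / p1)"
    using assms(1) unfolding gaussian_type_def by blast
  obtain C where "C > 0" and C: "\<And>k (x :: nat \<Rightarrow> 'x) (M :: (nat \<Rightarrow> real) measure) g. prob_space M \<Longrightarrow>
      iid_std_gaussians M k g \<Longrightarrow> (\<Sum>i<k. norm (x i) powr p2) powr (1 / p2) \<le> C * gaussian_L2_norm M k g x"
    using assms(2) unfolding gaussian_cotype_def by blast
  have "orthogonal_bound TYPE('x) p1 p2 (C * \<bar>T\<bar>)"
    unfolding orthogonal_bound_def
  proof (intro allI impI)
    fix N :: nat and U and x :: "nat \<Rightarrow> 'x"
    assume U: "orthogonal_mat_on {..<N} U"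
    let ?G = "gaussian_pi N" and ?V = "\<lambda>i j. U j i"
    \<comment> \<open>The coordinates and the rotated coordinates. Both live on
      \<open>gaussian_pi N\<close>, a measure on the sample type fixed in the definitions of type
      and cotype.\<close>
    let ?g = "\<lambda>i \<omega>. \<omega> i" and ?g' = "\<lambda>i \<omega>. mat_mul_vec N ?V \<omega> i"
    let ?p = "(\<Sum>j<N. norm (x j) powr p1) powr (1 / p1)"
    have G: "prob_space ?G"
      unfolding gaussian_pi_def by (intro prob_space_PiM prob_space_std_normal)
    have "distr ?G ?G (\<lambda>\<omega>. \<lambda>i\<in>{..<N}. \<omega> i) = distr ?G ?G (\<lambda>\<omega>. \<omega>)"
      by (intro distr_cong) (auto simp: gaussian_pi_def space_PiM)
    then have g: "iid_std_gaussians ?G N ?g"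
      by (intro iid_std_gaussians_of_distr G) (auto simp: gaussian_pi_def)
    have "(\<lambda>\<omega>. \<lambda>i\<in>{..<N}. mat_mul_vec N ?V \<omega> i) = mat_mul_vec N ?V"
      by (auto simp: mat_mul_vec_def fun_eq_iff)
    moreover have "?g' i \<in> borel_measurable ?G" for i
      using mat_mul_vec_component_measurable measurable_cong_sets[OF sets_gaussian_pi HOL.refl] by blast
    ultimately have g': "iid_std_gaussians ?G N ?g'"
      using distr_gaussian_pi_orthogonal[OF orthogonal_mat_on_transpose[OF U]]
      by (intro iid_std_gaussians_of_distr G) auto
    have "(\<Sum>i<N. \<omega> i *\<^sub>R (\<Sum>j<N. U i j *\<^sub>R x j)) = (\<Sum>j<N. mat_mul_vec N ?V \<omega> j *\<^sub>R x j)" for \<omega>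
    proof -
      have "(\<Sum>i<N. \<omega> i *\<^sub>R (\<Sum>j<N. U i j *\<^sub>R x j)) = (\<Sum>i<N. \<Sum>j<N. (U i j * \<omega> i) *\<^sub>R x j)"
        by (simp add: scaleR_sum_right mult.commute)
      also have "\<dots> = (\<Sum>j<N. mat_mul_vec N ?V \<omega> j *\<^sub>R x j)"
        by (subst sum.swap) (simp add: mat_mul_vec_def scaleR_sum_left)
      finally show ?thesis .
    qed
    then have eq: "gaussian_L2_norm ?G N ?g (\<lambda>i. \<Sum>j<N. U i j *\<^sub>R x j) = gaussian_L2_norm ?G N ?g' x"
      by (simp add: gaussian_L2_norm_def)
    have "gaussian_L2_norm ?G N ?g' x \<le> T * ?p"
      by (rule T[OF G g'])
    also have "\<dots> \<le> \<bar>T\<bar> * ?p"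
      by (intro mult_right_mono) auto
    \<comment> \<open>The sign of \<open>T\<close> is not given; its absolute value makes the final
      constant nonnegative.\<close>
    finally have "C * gaussian_L2_norm ?G N ?g (\<lambda>i. \<Sum>j<N. U i j *\<^sub>R x j) \<le> C * \<bar>T\<bar> * ?p"
      using \<open>C > 0\<close> by (simp add: eq)
    with C[OF G g, of "\<lambda>i. \<Sum>j<N. U i j *\<^sub>R x j"]
    show "(\<Sum>i<N. norm (\<Sum>j<N. U i j *\<^sub>R x j) powr p2) powr (1 / p2) \<le> C * \<bar>T\<bar> * ?p"
      by linarith
  qed
  with \<open>C > 0\<close> show ?thesis
    by (intro that[of "C * \<bar>T\<bar>"]) auto
qed

text \<open>Transport along an enumeration of \<open>I\<close>.\<close>

lemma orthogonal_bound_finite: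
  fixes x :: "'i \<Rightarrow> 'x::real_normed_vector"
  assumes K: "orthogonal_bound TYPE('x) p1 p2 K" and I: "finite I" and U: "orthogonal_mat_on I U"
  shows "(\<Sum>i\<in>I. norm (\<Sum>j\<in>I. U i j *\<^sub>R x j) powr p2) powr (1 / p2)
    \<le> K * (\<Sum>j\<in>I. norm (x j) powr p1) powr (1 / p1)"
proof -
  obtain h where h: "bij_betw h {..<card I} I"
    using ex_bij_betw_nat_finite[OF I] by (auto simp: atLeast0LessThan)
  have sum_h: "(\<Sum>i<card I. f (h i)) = (\<Sum>i\<in>I. f i)" for f :: "'i \<Rightarrow> 'c::comm_monoid_add"
    by (rule sum.reindex_bij_betw[OF h])
  have "orthogonal_mat_on {..<card I} (\<lambda>i j. U (h i) (h j))"
    unfolding orthogonal_mat_on_def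
  proof (intro conjI ballI)
    fix i k assume ik: "i \<in> {..<card I}" "k \<in> {..<card I}"
    then have hI: "h i \<in> I" "h k \<in> I" and inj: "h i = h k \<longleftrightarrow> i = k"
      using h by (auto simp: bij_betw_def inj_on_eq_iff)
    show "(\<Sum>j<card I. U (h i) (h j) * U (h k) (h j)) = of_bool (i = k)"
      using U hI inj sum_h[of "\<lambda>j. U (h i) j * U (h k) j"] by (simp add: orthogonal_mat_on_def)
    show "(\<Sum>j<card I. U (h j) (h i) * U (h j) (h k)) = of_bool (i = k)"
      using U hI inj sum_h[of "\<lambda>j. U j (h i) * U j (h k)"] by (simp add: orthogonal_mat_on_def)
  qed
  from K[unfolded orthogonal_bound_def, rule_format, OF this, of "\<lambda>j. x (h j)"]
  have "(\<Sum>i<card I. norm (\<Sum>j<card I. U (h i) (h j) *\<^sub>R x (h j)) powr p2) powr (1 / p2)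
      \<le> K * (\<Sum>j<card I. norm (x (h j)) powr p1) powr (1 / p1)"
    .
  then show ?thesis
    using sum_h[of "\<lambda>j. U _ j *\<^sub>R x j"] sum_h[of "\<lambda>i. norm (\<Sum>j\<in>I. U i j *\<^sub>R x j) powr p2"]
      sum_h[of "\<lambda>j. norm (x j) powr p1"] by simp
qed

section \<open>The orthogonal incidence matrix of the affine plane\<close>

text \<open>
  The normalised and centred incidence matrix between the lines \<open>c = d - s * a * b\<close> and the
  points \<open>(a, c)\<close> of the affine plane over the field with \<open>q\<close> elements is a partial isometry
  whose kernel consists of the functions of \<open>a\<close>; the last summand makes it orthogonal.
\<close>

definition incidence_mat :: "nat \<Rightarrow> int \<Rightarrow> int \<times> int \<Rightarrow> int \<times> int \<Rightarrow> real" where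
  "incidence_mat q s = (\<lambda>(b, d) (a, c).
     (of_bool (c = (d - s * a * b) mod int q) - 1 / real q) / sqrt (real q) + of_bool (a = b) / real q)"

lemma bij_betw_mult_mod:
  assumes "q > 0" "coprime r (int q)"
  shows "bij_betw (\<lambda>a. (r * a) mod int q) {0..<int q} {0..<int q}"
proof -
  have "inj_on (\<lambda>a. (r * a) mod int q) {0..<int q}"
  proof (rule inj_onI)
    fix a a' assume a: "a \<in> {0..<int q}" "a' \<in> {0..<int q}" "(r * a) mod int q = (r * a') mod int q"
    then have "[a = a'] (mod int q)"
      using assms(2) by (auto simp: cong_mult_lcancel cong_def[symmetric] coprime_commute)
    with a show "a = a'" by (simp add: cong_def)
  qed
  moreover have "(\<lambda>a. (r * a) mod int q) ` {0..<int q} \<subseteq> {0..<int q}"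
    using assms(1) by auto
  ultimately show ?thesis
    unfolding bij_betw_def using endo_inj_surj[of "{0..<int q}"] by auto
qed

text \<open>Two lines of different slopes meet in exactly one point, because
  \<open>s * (b - b')\<close> is invertible modulo \<open>q\<close>; parallel lines coincide or are
  disjoint.\<close>

lemma sum_of_bool_line:
  assumes q: "q > 0" and b: "b \<noteq> b' \<Longrightarrow> coprime (s * (b - b')) (int q)"
    and d: "d \<in> {0..<int q}" "d' \<in> {0..<int q}"
  shows "(\<Sum>a\<in>{0..<int q}. of_bool ((d - s * a * b) mod int q = (d' - s * a * b') mod int q))
    = (if b = b' then real q * of_bool (d = d') else 1)"
proof (cases "b = b'")
  case True
  have "(d - s * a * b) mod int q = (d' - s * a * b) mod int q \<longleftrightarrow> d = d'" for a
  proof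
    assume "(d - s * a * b) mod int q = (d' - s * a * b) mod int q"
    then have "(d - s * a * b + s * a * b) mod int q = (d' - s * a * b + s * a * b) mod int q"
      by (rule mod_add_cong) simp
    with d show "d = d'" by simp
  qed simp
  with True show ?thesis by simp
next
  case False
  let ?r = "s * (b - b')"
  have "(d - s * a * b) mod int q = (d' - s * a * b') mod int q \<longleftrightarrow> (?r * a) mod int q = (d - d') mod int q" for a
    by (auto simp: mod_eq_dvd_iff algebra_simps)
  then have "(\<Sum>a\<in>{0..<int q}. of_bool ((d - s * a * b) mod int q = (d' - s * a * b') mod int q))
      = (\<Sum>a\<in>{0..<int q}. of_bool ((?r * a) mod int q = (d - d') mod int q) :: real)"
    by simp
  also have "\<dots> = (\<Sum>a\<in>{0..<int q}. of_bool (a = (d - d') mod int q))"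
    by (rule sum.reindex_bij_betw[OF bij_betw_mult_mod[OF q b[OF False]]])
  also have "\<dots> = 1"
    using q by (simp add: of_bool_def)
  finally show ?thesis using False by simp
qed

text \<open>The sum is taken first over \<open>c\<close>, then over \<open>a\<close>. For equal
  slopes the centred part contributes \<open>of_bool (d = d') - 1 / q\<close>, and the last summand
  of the matrix restores \<open>1 / q\<close>; for different slopes the single intersection point
  cancels the centring.\<close>

lemma incidence_mat_rows:
  assumes q: "Factorial_Ring.prime q" and s: "coprime s (int q)"
    and bd: "b \<in> {0..<int q}" "d \<in> {0..<int q}" "b' \<in> {0..<int q}" "d' \<in> {0..<int q}"
  shows "(\<Sum>j\<in>{0..<int q} \<times> {0..<int q}. incidence_mat q s (b, d) j * incidence_mat q s (b', d') j)
    = of_bool ((b, d) = (b', d'))"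
proof -
  let ?Q = "{0..<int q}" and ?q = "real q"
  have q0: "q > 0" using q by (simp add: prime_gt_0_nat)
  define l where "l a = (d - s * a * b) mod int q" for a
  define l' where "l' a = (d' - s * a * b') mod int q" for a
  have l: "l a \<in> ?Q" "l' a \<in> ?Q" for a using q0 by (auto simp: l_def l'_def)
  \<comment> \<open>\<open>u\<close> and \<open>v\<close> stand for \<open>of_bool (a = b)\<close>
    and \<open>of_bool (a = b')\<close>. Mixed terms vanish because a centred indicator sums to
    \<open>0\<close> over \<open>c\<close>.\<close>
  have inner: "(\<Sum>c\<in>?Q. ((of_bool (c = l a) - 1 / ?q) / sqrt ?q + u / ?q) * ((of_bool (c = l' a) - 1 / ?q) / sqrt ?q + v / ?q))
      = (of_bool (l a = l' a) - 1 / ?q) / ?q + u * v / ?q" for a u v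
  proof -
    \<comment> \<open>With \<open>r\<close> for the inverse square root the computation becomes
      polynomial, reduced by \<open>r * r * ?q = 1\<close>.\<close>
    define r where "r = 1 / sqrt ?q"
    have r: "r * r * ?q = 1" using q0 by (simp add: r_def)
    let ?x = "\<lambda>c. of_bool (c = l a) :: real" and ?y = "\<lambda>c. of_bool (c = l' a) :: real"
    have "(\<Sum>c\<in>?Q. ?x c * ?y c) = (\<Sum>c\<in>?Q. if c = l a then of_bool (l a = l' a) else 0)"
      by (intro sum.cong) auto
    then have sums: "(\<Sum>c\<in>?Q. ?x c) = 1" "(\<Sum>c\<in>?Q. ?y c) = 1" "(\<Sum>c\<in>?Q. ?x c * ?y c) = of_bool (l a = l' a)"
      using l[of a] by (simp_all add: of_bool_def)
    have expand: "(r * (x - r\<^sup>2) + u * r\<^sup>2) * (r * (y - r\<^sup>2) + v * r\<^sup>2)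
        = r\<^sup>2 * (x * y) + (r ^ 3 * v - r ^ 4) * x + (r ^ 3 * u - r ^ 4) * y
            + (r ^ 6 - r ^ 5 * (u + v) + r ^ 4 * (u * v))" for x y
      by (simp add: algebra_simps eval_nat_numeral)
    have "(\<Sum>c\<in>?Q. (r * (?x c - r\<^sup>2) + u * r\<^sup>2) * (r * (?y c - r\<^sup>2) + v * r\<^sup>2))
        = (\<Sum>c\<in>?Q. r\<^sup>2 * (?x c * ?y c) + (r ^ 3 * v - r ^ 4) * ?x c + (r ^ 3 * u - r ^ 4) * ?y c
            + (r ^ 6 - r ^ 5 * (u + v) + r ^ 4 * (u * v)))"
      by (simp only: expand)
    also have "\<dots> = r\<^sup>2 * of_bool (l a = l' a) + (r ^ 3 * v - r ^ 4) + (r ^ 3 * u - r ^ 4)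
        + ?q * (r ^ 6 - r ^ 5 * (u + v) + r ^ 4 * (u * v))"
      by (simp only: sum.distrib sum_distrib_left[symmetric] sums) (simp add: algebra_simps)
    also have "?q * (r ^ 6 - r ^ 5 * (u + v) + r ^ 4 * (u * v))
        = (r * r * ?q) * (r ^ 4 - r ^ 3 * (u + v) + r\<^sup>2 * (u * v))"
      by (simp add: algebra_simps eval_nat_numeral)
    also have "r\<^sup>2 * of_bool (l a = l' a) + (r ^ 3 * v - r ^ 4) + (r ^ 3 * u - r ^ 4) + \<dots>
        = r\<^sup>2 * (of_bool (l a = l' a) - r\<^sup>2) + u * v * r\<^sup>2"
      unfolding r by (simp add: algebra_simps eval_nat_numeral)
    moreover have r2: "r\<^sup>2 = 1 / ?q" using q0 by (simp add: r_def power_divide)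
    ultimately show ?thesis
      unfolding r2 by (simp add: r_def)
  qed
  have "(\<Sum>j\<in>?Q \<times> ?Q. incidence_mat q s (b, d) j * incidence_mat q s (b', d') j)
      = (\<Sum>a\<in>?Q. (of_bool (l a = l' a) - 1 / ?q) / ?q + of_bool (a = b) * of_bool (a = b') / ?q)"
    by (simp add: sum.cartesian_product' incidence_mat_def inner flip: l_def l'_def)
  also have "\<dots> = ((\<Sum>a\<in>?Q. of_bool (l a = l' a)) - 1) / ?q + (\<Sum>a\<in>?Q. of_bool (a = b) * of_bool (a = b') / ?q)"
    using q0 by (simp add: sum.distrib sum_divide_distrib[symmetric] sum_subtractf)
  also have "(\<Sum>a\<in>?Q. of_bool (a = b) * of_bool (a = b') / ?q) = of_bool (b = b') / ?q"
  proof -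
    have "(\<Sum>a\<in>?Q. of_bool (a = b) * of_bool (a = b') / ?q) = (\<Sum>a\<in>?Q. if a = b then of_bool (b = b') / ?q else 0)"
      by (intro sum.cong) auto
    with bd show ?thesis by simp
  qed
  also have "(\<Sum>a\<in>?Q. of_bool (l a = l' a)) = (if b = b' then ?q * of_bool (d = d') else 1)"
    unfolding l_def l'_def
  proof (rule sum_of_bool_line[OF q0])
    assume "b \<noteq> b'"
    with bd have "\<not> int q dvd b - b'"
      by (metis atLeastLessThan_iff mod_eq_dvd_iff mod_pos_pos_trivial)
    then have "coprime (b - b') (int q)"
      using q by (metis coprime_commute prime_imp_coprime prime_nat_int_transfer)
    with s show "coprime (s * (b - b')) (int q)" by simp
  qed (use bd in auto)
  finally show ?thesis
    using q0 by (cases "b = b'"; cases "d = d'") (simp_all add: field_simps)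
qed

text \<open>Point-line duality: solving \<open>c = d - s * a * b\<close> for \<open>d\<close>
  changes the sign of \<open>s\<close>. The parameter \<open>s\<close> is what lets the column
  relations follow from the row relations.\<close>

lemma incidence_mat_transpose:
  assumes "a \<in> {0..<int q}" "b \<in> {0..<int q}" "c \<in> {0..<int q}" "d \<in> {0..<int q}"
  shows "incidence_mat q s (b, d) (a, c) = incidence_mat q (- s) (a, c) (b, d)"
proof -
  have "c = (d - s * a * b) mod int q \<longleftrightarrow> d = (c + s * b * a) mod int q"
  proof -
    have "c = (d - s * a * b) mod int q \<longleftrightarrow> c mod int q = (d - s * a * b) mod int q"
      using assms by simp
    also have "\<dots> \<longleftrightarrow> d mod int q = (c + s * b * a) mod int q"
      unfolding mod_eq_dvd_iff by (subst dvd_minus_iff[symmetric]) (simp add: algebra_simps)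
    finally show ?thesis using assms by simp
  qed
  then show ?thesis
    unfolding incidence_mat_def by (auto simp: of_bool_def)
qed

lemma orthogonal_incidence_mat:
  assumes "Factorial_Ring.prime q" and s: "coprime s (int q)"
  shows "orthogonal_mat_on ({0..<int q} \<times> {0..<int q}) (incidence_mat q s)"
  unfolding orthogonal_mat_on_def
proof (intro conjI ballI; clarify)
  let ?Q = "{0..<int q}"
  fix b d b' d' assume bd: "b \<in> ?Q" "d \<in> ?Q" "b' \<in> ?Q" "d' \<in> ?Q"
  show "(\<Sum>j\<in>?Q \<times> ?Q. incidence_mat q s (b, d) j * incidence_mat q s (b', d') j) = of_bool ((b, d) = (b', d'))"
    using incidence_mat_rows[OF assms bd] .
  have "(\<Sum>j\<in>?Q \<times> ?Q. incidence_mat q s j (b, d) * incidence_mat q s j (b', d'))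
      = (\<Sum>j\<in>?Q \<times> ?Q. incidence_mat q (- s) (b, d) j * incidence_mat q (- s) (b', d') j)"
  proof (intro sum.cong HOL.refl, clarify)
    fix a c assume "a \<in> ?Q" "c \<in> ?Q"
    with bd have "incidence_mat q s (a, c) (b, d) = incidence_mat q (- s) (b, d) (a, c)"
      "incidence_mat q s (a, c) (b', d') = incidence_mat q (- s) (b', d') (a, c)"
      by (intro incidence_mat_transpose; simp)+
    then show "incidence_mat q s (a, c) (b, d) * incidence_mat q s (a, c) (b', d')
        = incidence_mat q (- s) (b, d) (a, c) * incidence_mat q (- s) (b', d') (a, c)"
      by (simp only:)
  qed
  then show "(\<Sum>j\<in>?Q \<times> ?Q. incidence_mat q s j (b, d) * incidence_mat q s j (b', d')) = of_bool ((b, d) = (b', d'))"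
    using incidence_mat_rows[OF assms(1) _ bd, of "- s"] s by simp
qed

section \<open>Affine actions of cyclic and Heisenberg groups\<close>

definition mean :: "'i set \<Rightarrow> ('i \<Rightarrow> 'x::real_vector) \<Rightarrow> 'x" where
  "mean J g = (1 / real (card J)) *\<^sub>R (\<Sum>j\<in>J. g j)"

text \<open>Unlike affine isometries, these maps are closed under means, so averages over group
  actions stay in the class.\<close>

definition nonexpansive_affine :: "('x::real_normed_vector \<Rightarrow> 'x) \<Rightarrow> bool" where
  "nonexpansive_affine f \<longleftrightarrow>
     (\<exists>L b. linear L \<and> (\<forall>x. norm (L x) \<le> norm x) \<and> (\<forall>x. f x = L x + b))"

lemma mean_const: "finite J \<Longrightarrow> J \<noteq> {} \<Longrightarrow> mean J (\<lambda>_. y) = y"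
  by (simp add: mean_def sum_constant_scaleR)

lemma mean_cong: "(\<And>j. j \<in> J \<Longrightarrow> g j = h j) \<Longrightarrow> mean J g = mean J h"
  by (simp add: mean_def)

lemma mean_add: "mean J (\<lambda>j. g j + h j) = mean J g + mean J h"
  by (simp add: mean_def sum.distrib scaleR_add_right)

lemma mean_diff: "mean J (\<lambda>j. g j - h j) = mean J g - mean J h"
  by (simp add: mean_def sum_subtractf scaleR_diff_right)

lemma mean_linear: "linear L \<Longrightarrow> L (mean J g) = mean J (\<lambda>j. L (g j))"
  by (simp add: mean_def linear_sum linear_scale)

lemma mean_swap: "mean I (\<lambda>i. mean J (g i)) = mean J (\<lambda>j. mean I (\<lambda>i. g i j))"
  by (simp add: mean_def scaleR_sum_right[symmetric] sum.swap[of _ I] mult.commute)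

lemma mean_reindex_bij: "bij_betw h J J \<Longrightarrow> mean J (\<lambda>j. g (h j)) = mean J g"
  by (simp add: mean_def sum.reindex_bij_betw)

lemma norm_mean_le_mean: "norm (mean J g) \<le> mean J (\<lambda>j. norm (g j))"
  by (simp add: mean_def divide_right_mono norm_sum)

lemma mean_mono: "(\<And>j. j \<in> J \<Longrightarrow> g j \<le> h j) \<Longrightarrow> mean J g \<le> (mean J h :: real)"
  by (simp add: mean_def divide_right_mono sum_mono)

lemma norm_mean_le:
  "finite J \<Longrightarrow> J \<noteq> {} \<Longrightarrow> (\<And>j. j \<in> J \<Longrightarrow> norm (g j) \<le> D) \<Longrightarrow> norm (mean J g) \<le> D"
  using norm_mean_le_mean[of J g] mean_mono[of J "\<lambda>j. norm (g j)" "\<lambda>_. D"] by (simp add: mean_const)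

lemma nonexpansive_affine_mean:
  assumes "nonexpansive_affine f" "finite J" "J \<noteq> {}"
  shows "f (mean J g) = mean J (\<lambda>j. f (g j))"
proof -
  obtain L b where L: "linear L" and f: "\<And>x. f x = L x + b"
    using assms(1) by (auto simp: nonexpansive_affine_def)
  show ?thesis
    using assms(2,3) by (simp add: f mean_add mean_const mean_linear[OF L])
qed

lemma nonexpansive_affine_dist:
  assumes "nonexpansive_affine f"
  shows "norm (f x - f y) \<le> norm (x - y)"
proof -
  obtain L b where L: "linear L" "\<And>x. norm (L x) \<le> norm x" and f: "\<And>x. f x = L x + b"
    using assms(1) by (auto simp: nonexpansive_affine_def)
  have "f x - f y = L (x - y)" by (simp add: f linear_diff[OF L(1)])
  with L(2) show ?thesis by metis
qed

lemma nonexpansive_affine_means: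
  assumes "\<And>j. j \<in> J \<Longrightarrow> nonexpansive_affine (F j)" "finite J" "J \<noteq> {}"
  shows "nonexpansive_affine (\<lambda>x. mean J (\<lambda>j. F j x))"
proof -
  have "\<forall>j\<in>J. \<exists>L b. linear L \<and> (\<forall>x. norm (L x) \<le> norm x) \<and> (\<forall>x. F j x = L x + b)"
    using assms(1) by (simp add: nonexpansive_affine_def)
  then obtain L b where L: "\<And>j. j \<in> J \<Longrightarrow> linear (L j)" "\<And>j x. j \<in> J \<Longrightarrow> norm (L j x) \<le> norm x"
    and F: "\<And>j x. j \<in> J \<Longrightarrow> F j x = L j x + b j"
    by metis
  have "linear (\<lambda>x. mean J (\<lambda>j. L j x))"
    using L(1) unfolding mean_def by (intro linear_compose_scale_right linear_compose_sum) auto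
  moreover have "norm (mean J (\<lambda>j. L j x)) \<le> norm x" for x
    using assms(2,3) L(2) by (intro norm_mean_le) auto
  moreover have "mean J (\<lambda>j. F j x) = mean J (\<lambda>j. L j x) + mean J b" for x
    using F by (simp add: mean_add[symmetric] cong: mean_cong)
  ultimately show ?thesis
    unfolding nonexpansive_affine_def by blast
qed

section \<open>Actions of cyclic groups and their averages\<close>

text \<open>An action of Z/q, encoded as a \<open>q\<close>-periodic action of the integers so that
  exponents such as \<open>d - a * b\<close> need no reduction. Periodicity makes every
  \<open>A s\<close> invertible, hence an isometry.\<close>

locale cyclic_action =
  fixes q :: nat and A :: "int \<Rightarrow> 'x::real_normed_vector \<Rightarrow> 'x"
  assumes q: "q > 0"
    and nonexpansive: "nonexpansive_affine (A s)"
    and add: "A (s + t) x = A s (A t x)"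
    and period: "A (int q) x = x"
begin

definition avg :: "'x \<Rightarrow> 'x" where
  "avg x = mean {0..<int q} (\<lambda>s. A s x)"

lemma zero: "A 0 x = x"
  using add[of 0 "int q" x] by (simp add: period)

lemma inverse: "A (- s) (A s x) = x"
  using add[of "- s" s x] by (simp add: zero)

lemma add_mult_period: "A (s + int q * k) x = A s x"
proof (induction k rule: int_induct[where k = 0])
  case (step1 k)
  have "A (s + int q * (k + 1)) x = A (s + int q * k) (A (int q) x)"
    by (simp add: add[symmetric] algebra_simps)
  with step1 show ?case by (simp add: period)
next
  case (step2 k)
  have "A (s + int q * k) x = A (s + int q * (k - 1)) (A (int q) x)"
    by (simp add: add[symmetric] algebra_simps)
  with step2 show ?case by (simp add: period)
qed simp

lemma mod_period: "A (s mod int q) x = A s x"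
  using add_mult_period[of "s mod int q" "s div int q" x] by simp

lemma isometry: "norm (A s x - A s y) = norm (x - y)"
proof (rule antisym)
  show "norm (A s x - A s y) \<le> norm (x - y)"
    by (rule nonexpansive_affine_dist[OF nonexpansive])
  show "norm (x - y) \<le> norm (A s x - A s y)"
    using nonexpansive_affine_dist[OF nonexpansive, of "- s" "A s x" "A s y"] by (simp add: inverse)
qed

lemma A_mean: "finite J \<Longrightarrow> J \<noteq> {} \<Longrightarrow> A s (mean J g) = mean J (\<lambda>j. A s (g j))"
  by (rule nonexpansive_affine_mean[OF nonexpansive])

lemma range_finite: "finite {0..<int q}" "{0..<int q} \<noteq> {}"
  using q by auto

lemma A_avg: "A t (avg x) = avg x"
proof -
  have "bij_betw (\<lambda>s. (t + s) mod int q) {0..<int q} {0..<int q}"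
  proof -
    have "inj_on (\<lambda>s. (t + s) mod int q) {0..<int q}"
    proof (rule inj_onI)
      fix s s' assume s: "s \<in> {0..<int q}" "s' \<in> {0..<int q}" "(t + s) mod int q = (t + s') mod int q"
      then have "(t + s - t) mod int q = (t + s' - t) mod int q"
        by (intro mod_diff_cong) auto
      with s show "s = s'" by simp
    qed
    moreover have "(\<lambda>s. (t + s) mod int q) ` {0..<int q} \<subseteq> {0..<int q}"
      using q by auto
    ultimately show ?thesis
      unfolding bij_betw_def using endo_inj_surj[of "{0..<int q}"] by auto
  qed
  from mean_reindex_bij[OF this, of "\<lambda>s. A s x"]
  have "mean {0..<int q} (\<lambda>s. A (t + s) x) = avg x"
    by (simp add: avg_def mod_period)
  then show ?thesis
    by (simp add: avg_def A_mean[OF range_finite] add)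
qed

lemma avg_fixed: "(\<And>s. A s x = x) \<Longrightarrow> avg x = x"
  using mean_const[OF range_finite] by (simp add: avg_def)

lemma avg_nonexpansive: "nonexpansive_affine avg"
  unfolding avg_def using nonexpansive range_finite by (intro nonexpansive_affine_means) auto

lemma avg_commute:
  assumes "nonexpansive_affine f" "\<And>s. f (A s x) = A s (f x)"
  shows "f (avg x) = avg (f x)"
  using assms by (simp add: avg_def nonexpansive_affine_mean[OF _ range_finite])

end

abbreviation cyclic_avg :: "nat \<Rightarrow> (int \<Rightarrow> 'x \<Rightarrow> 'x) \<Rightarrow> 'x \<Rightarrow> 'x::real_normed_vector" where
  "cyclic_avg \<equiv> cyclic_action.avg"

text \<open>Exchanging the two generators of a Heisenberg group inverts its centre. Negation
  permutes the residues, so the average does not change.\<close>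

lemma cyclic_action_uminus:
  assumes "cyclic_action q A"
  shows "cyclic_action q (\<lambda>s. A (- s))" "cyclic_avg q (\<lambda>s. A (- s)) = cyclic_avg q A"
proof -
  interpret A: cyclic_action q A by fact
  show *: "cyclic_action q (\<lambda>s. A (- s))"
  proof
    show "A (- (s + t)) x = A (- s) (A (- t) x)" for s t x
      by (simp add: A.add[symmetric])
    show "A (- int q) x = x" for x
      using A.inverse[of "int q" x] by (simp add: A.period)
  qed (rule A.q A.nonexpansive)+
  interpret A': cyclic_action q "\<lambda>s. A (- s)" by fact
  have "bij_betw (\<lambda>s. (- 1 * s) mod int q) {0..<int q} {0..<int q}"
    by (rule bij_betw_mult_mod) (use A.q in auto)
  from mean_reindex_bij[OF this, of "\<lambda>s. A s _"]
  have "mean {0..<int q} (\<lambda>s. A (- s) x) = mean {0..<int q} (\<lambda>s. A s x)" for x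
    by (simp add: A.mod_period)
  then show "cyclic_avg q (\<lambda>s. A (- s)) = cyclic_avg q A"
    by (simp add: fun_eq_iff A.avg_def A'.avg_def)
qed

section \<open>Actions of Heisenberg groups\<close>

text \<open>The action may be degenerate: a commuting pair \<open>A\<close>, \<open>B\<close> is
  covered by a trivial \<open>Z\<close>.\<close>

locale heisenberg_action =
  A: cyclic_action q A + B: cyclic_action q B + Z: cyclic_action q Z
  for q and A B Z :: "int \<Rightarrow> 'x::real_normed_vector \<Rightarrow> 'x" +
  assumes commutator: "A s (B t x) = Z (s * t) (B t (A s x))"
    and Z_A: "Z s (A t x) = A t (Z s x)"
    and Z_B: "Z s (B t x) = B t (Z s x)"
begin

lemma A_B_commute: "(\<And>r. Z r z = z) \<Longrightarrow> A s (B t z) = B t (A s z)"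
  by (simp add: commutator Z_A Z_B)

lemma Z_avg_A: "Z s (A.avg x) = A.avg (Z s x)" and Z_avg_B: "Z s (B.avg x) = B.avg (Z s x)"
  using A.avg_commute[OF Z.nonexpansive] B.avg_commute[OF Z.nonexpansive] Z_A Z_B by auto

text \<open>On points fixed by the centre the commutator disappears, so the two means can be
  interchanged.\<close>

lemma avg_A_B_commute:
  assumes "\<And>r. Z r z = z"
  shows "A.avg (B.avg z) = B.avg (A.avg z)"
proof -
  have "A.avg (B.avg z) = mean {0..<int q} (\<lambda>s. mean {0..<int q} (\<lambda>t. A s (B t z)))"
    by (simp add: A.avg_def B.avg_def A.A_mean[OF A.range_finite])
  also have "\<dots> = mean {0..<int q} (\<lambda>t. mean {0..<int q} (\<lambda>s. B t (A s z)))"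
    by (subst mean_swap) (simp add: A_B_commute[OF assms])
  also have "\<dots> = B.avg (A.avg z)"
    by (simp add: A.avg_def B.avg_def B.A_mean[OF A.range_finite])
  finally show ?thesis .
qed

text \<open>\<open>Z.avg x\<close> is fixed by the centre, and both averages preserve this. Since
  they commute there, \<open>y\<close> lies in the image of each of them.\<close>

lemma avg_avg_avg_fixed:
  fixes x
  defines "y \<equiv> A.avg (B.avg (Z.avg x))"
  shows "A s y = y" "B s y = y" "Z s y = y"
proof -
  show "A s y = y" by (simp add: y_def A.A_avg)
  show "Z s y = y" by (simp add: y_def Z_avg_A Z_avg_B Z.A_avg)
  have "y = B.avg (A.avg (Z.avg x))"
    unfolding y_def by (rule avg_A_B_commute) (rule Z.A_avg)
  then show "B s y = y" by (simp add: B.A_avg)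
qed

lemma swap: "heisenberg_action q B A (\<lambda>s. Z (- s))"
proof -
  interpret Z': cyclic_action q "\<lambda>s. Z (- s)"
    by (rule cyclic_action_uminus) (rule Z.cyclic_action_axioms)
  show ?thesis
  proof
    fix s t x
    have "Z (- (s * t)) (A t (B s x)) = Z (- (t * s)) (Z (t * s) (B s (A t x)))"
      by (simp add: commutator mult.commute)
    then show "B s (A t x) = Z (- (s * t)) (A t (B s x))"
      by (simp add: Z.inverse)
  qed (simp_all add: Z_A Z_B)
qed

end

section \<open>Norm estimate for linear Heisenberg actions\<close>

text \<open>For a \<open>B\<close>-fixed \<open>v\<close> the points \<open>Z c (A a v)\<close> with
  \<open>(a, c)\<close> on the line \<open>(b, d)\<close> sum to \<open>q\<close> times
  \<open>Z d (B b (A.avg v))\<close>. The matrix thus turns \<open>q\<^sup>2\<close> vectors of norm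
  \<open>norm v\<close> into \<open>q\<^sup>2\<close> vectors of norm
  \<open>sqrt q * norm (A.avg v)\<close>, which yields the exponent
  \<open>2 / p1 - 2 / p2 - 1 / 2\<close>.\<close>

lemma heisenberg_linear_estimate:
  fixes A B Z :: "int \<Rightarrow> 'x::real_normed_vector \<Rightarrow> 'x"
  assumes K: "orthogonal_bound TYPE('x) p1 p2 K" "K \<ge> 0" and q: "Factorial_Ring.prime q"
    and p: "p1 > 0" "p2 > 0"
    and heis: "heisenberg_action q A B Z"
    and fix0: "\<And>s. A s 0 = 0" "\<And>s. B s 0 = 0" "\<And>s. Z s 0 = 0"
  shows "norm (cyclic_avg q A (cyclic_avg q B (u - cyclic_avg q Z u)))
    \<le> 2 * K * real q powr (2 * (1 / p1 - 1 / p2) - 1 / 2) * norm u"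
proof -
  interpret heisenberg_action q A B Z by fact
  let ?Q = "{0..<int q}" and ?q = "real q"
  have q0: "?q > 0" using A.q by simp
  have Q: "finite ?Q" "?Q \<noteq> {}" by (rule A.range_finite)+
  have mean_sum: "(\<Sum>s\<in>?Q. g s) = ?q *\<^sub>R mean ?Q g" for g :: "int \<Rightarrow> 'x"
    using q0 by (simp add: mean_def)
  have norms: "norm (A s x) = norm x" "norm (B s x) = norm x" "norm (Z s x) = norm x" for s x
    using A.isometry[of s x 0] B.isometry[of s x 0] Z.isometry[of s x 0] by (simp_all add: fix0)
  have lin: "linear f" if f_aff: "nonexpansive_affine f" and f0: "f 0 = 0" for f :: "'x \<Rightarrow> 'x"
  proof -
    obtain L b where L: "linear L" and f: "\<And>x. f x = L x + b"
      using f_aff by (auto simp: nonexpansive_affine_def)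
    have "b = 0" using f0 f[of 0] linear_0[OF L] by simp
    with f have "f = L" by (simp add: fun_eq_iff)
    with L show ?thesis by simp
  qed
  have avg0: "B.avg 0 = 0" "Z.avg 0 = 0"
    using B.avg_fixed[of 0] Z.avg_fixed[of 0] by (simp_all add: fix0)
  \<comment> \<open>Subtracting the \<open>Z\<close>-average makes the sums of \<open>f\<close> over
    \<open>c\<close> vanish, so the centring and the last summand of \<open>incidence_mat\<close>
    contribute nothing. The factor \<open>2\<close> in the statement bounds the norm of this
    subtraction.\<close>
  define w where "w = u - Z.avg u"
  define v where "v = B.avg w"
  define n where "n = norm (A.avg v)"
  have "Z.avg w = 0"
    unfolding w_def using linear_diff[OF lin[OF Z.avg_nonexpansive avg0(2)]] Z.avg_fixed[OF Z.A_avg] by simp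
  moreover have "Z.avg v = B.avg (Z.avg w)"
    unfolding v_def using Z.avg_commute[OF B.avg_nonexpansive] Z_avg_B by metis
  ultimately have Zv: "Z.avg v = 0"
    by (simp add: avg0)
  have Bv: "B s v = v" for s
    unfolding v_def by (rule B.A_avg)
  have "norm (Z.avg u) \<le> norm u"
    using nonexpansive_affine_dist[OF Z.avg_nonexpansive, of u 0] by (simp add: avg0)
  then have "norm w \<le> 2 * norm u"
    unfolding w_def using norm_triangle_ineq4[of u "Z.avg u"] by linarith
  moreover have "norm v \<le> norm w"
    unfolding v_def using nonexpansive_affine_dist[OF B.avg_nonexpansive, of w 0] by (simp add: avg0)
  ultimately have v: "norm v \<le> 2 * norm u" by linarith
  define f where "f = (\<lambda>(a, c). Z c (A a v))"
  have f_norm: "norm (f j) = norm v" for j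
    by (cases j) (simp add: f_def norms)
  have sum_f: "(\<Sum>c\<in>?Q. f (a, c)) = 0" for a
  proof -
    have "(\<Sum>c\<in>?Q. f (a, c)) = ?q *\<^sub>R Z.avg (A a v)"
      by (simp add: mean_sum f_def Z.avg_def)
    also have "Z.avg (A a v) = A a (Z.avg v)"
      by (rule Z.avg_commute[OF A.nonexpansive, symmetric]) (simp add: Z_A)
    finally show ?thesis by (simp add: Zv fix0)
  qed
  have transform: "(\<Sum>j\<in>?Q \<times> ?Q. incidence_mat q 1 (b, d) j *\<^sub>R f j) = sqrt ?q *\<^sub>R Z d (B b (A.avg v))" for b d
  proof -
    have "(\<Sum>j\<in>?Q \<times> ?Q. incidence_mat q 1 (b, d) j *\<^sub>R f j)
        = (\<Sum>a\<in>?Q. \<Sum>c\<in>?Q. incidence_mat q 1 (b, d) (a, c) *\<^sub>R f (a, c))"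
      by (simp add: sum.cartesian_product')
    also have "\<dots> = (\<Sum>a\<in>?Q. (1 / sqrt ?q) *\<^sub>R Z d (B b (A a v)))"
    proof (intro sum.cong HOL.refl)
      fix a assume "a \<in> ?Q"
      define l where "l = (d - a * b) mod int q"
      \<comment> \<open>The part of the matrix entry that is constant in \<open>c\<close>;
        \<open>sum_f\<close> annihilates it.\<close>
      define \<kappa> where "\<kappa> = of_bool (a = b) / ?q - 1 / ?q / sqrt ?q"
      have l: "l \<in> ?Q" using A.q by (simp add: l_def)
      have "(\<Sum>c\<in>?Q. incidence_mat q 1 (b, d) (a, c) *\<^sub>R f (a, c))
          = (\<Sum>c\<in>?Q. (if c = l then (1 / sqrt ?q) *\<^sub>R f (a, c) else 0) + \<kappa> *\<^sub>R f (a, c))"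
        by (intro sum.cong HOL.refl)
          (auto simp: incidence_mat_def l_def[symmetric] \<kappa>_def scaleR_add_left[symmetric] diff_divide_distrib)
      also have "\<dots> = (1 / sqrt ?q) *\<^sub>R f (a, l)"
        using l by (simp add: sum.distrib scaleR_sum_right[symmetric] sum_f)
      \<comment> \<open>As \<open>v\<close> is fixed by \<open>B b\<close>, this factor can be
        inserted; moving it past \<open>A a\<close> produces \<open>Z (a * b)\<close>, which frees
        the central exponent from \<open>a\<close>.\<close>
      also have "f (a, l) = Z (d - a * b) (A a (B b v))"
        by (simp add: f_def l_def Z.mod_period Bv)
      also have "\<dots> = Z (d - a * b) (Z (a * b) (B b (A a v)))"
        by (simp add: commutator)
      also have "\<dots> = Z d (B b (A a v))"
        by (simp add: Z.add[symmetric])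
      finally show "(\<Sum>c\<in>?Q. incidence_mat q 1 (b, d) (a, c) *\<^sub>R f (a, c)) = (1 / sqrt ?q) *\<^sub>R Z d (B b (A a v))" .
    qed
    also have "\<dots> = (1 / sqrt ?q) *\<^sub>R ?q *\<^sub>R mean ?Q (\<lambda>a. Z d (B b (A a v)))"
      by (simp only: mean_sum scaleR_sum_right[symmetric])
    also have "mean ?Q (\<lambda>a. Z d (B b (A a v))) = Z d (B b (A.avg v))"
      by (simp add: A.avg_def Z.A_mean[OF Q] B.A_mean[OF Q])
    finally show ?thesis
      using q0 by (simp add: real_div_sqrt)
  qed
  have card: "real (card (?Q \<times> ?Q)) = ?q\<^sup>2"
    by (simp add: card_cartesian_product power2_eq_square)
  have sum_const: "(\<Sum>j\<in>?Q \<times> ?Q. c powr r) powr (1 / r) = ?q powr (2 / r) * c"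
    if "c \<ge> 0" "r > 0" for c r :: real
  proof -
    have "(\<Sum>j\<in>?Q \<times> ?Q. c powr r) = ?q powr 2 * c powr r"
      using card q0 by (simp add: powr_numeral)
    then show ?thesis
      using that by (simp only: powr_mult powr_powr) simp
  qed
  have "orthogonal_mat_on (?Q \<times> ?Q) (incidence_mat q 1)"
    by (rule orthogonal_incidence_mat[OF q]) simp
  then have "(\<Sum>i\<in>?Q \<times> ?Q. norm (\<Sum>j\<in>?Q \<times> ?Q. incidence_mat q 1 i j *\<^sub>R f j) powr p2) powr (1 / p2)
      \<le> K * (\<Sum>j\<in>?Q \<times> ?Q. norm (f j) powr p1) powr (1 / p1)"
    by (intro orthogonal_bound_finite[OF K(1)]) auto
  also have "(\<Sum>i\<in>?Q \<times> ?Q. norm (\<Sum>j\<in>?Q \<times> ?Q. incidence_mat q 1 i j *\<^sub>R f j) powr p2)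
      = (\<Sum>i\<in>?Q \<times> ?Q. (sqrt ?q * n) powr p2)"
    by (intro sum.cong HOL.refl) (auto simp: transform norms n_def)
  \<comment> \<open>Each side is built from \<open>q\<^sup>2\<close> equal norms, whence the
    exponents \<open>2 / p2\<close> and \<open>2 / p1\<close>.\<close>
  finally have "?q powr (2 / p2) * (sqrt ?q * n) \<le> K * (?q powr (2 / p1) * norm v)"
    unfolding f_norm using sum_const[of "sqrt ?q * n" p2] sum_const[of "norm v" p1] p
    by (simp only: n_def norm_ge_zero mult_nonneg_nonneg real_sqrt_ge_zero of_nat_0_le_iff)
  then have "?q powr (2 / p2 + 1 / 2) * n \<le> ?q powr (2 / p1) * (K * norm v)"
    using q0 by (simp add: powr_add powr_half_sqrt mult_ac)
  then have "n \<le> ?q powr (2 / p1) * (K * norm v) / ?q powr (2 / p2 + 1 / 2)"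
    using q0 by (simp add: pos_le_divide_eq mult.commute)
  also have "\<dots> = K * ?q powr (2 * (1 / p1 - 1 / p2) - 1 / 2) * norm v"
  proof -
    have "2 / p1 - (2 / p2 + 1 / 2) = 2 * (1 / p1 - 1 / p2) - 1 / 2" by simp
    then have "?q powr (2 / p1) / ?q powr (2 / p2 + 1 / 2) = ?q powr (2 * (1 / p1 - 1 / p2) - 1 / 2)"
      by (metis powr_diff)
    then show ?thesis by (metis times_divide_eq_left mult.assoc mult.commute)
  qed
  also have "\<dots> \<le> K * ?q powr (2 * (1 / p1 - 1 / p2) - 1 / 2) * (2 * norm u)"
    using v K(2) by (intro mult_left_mono) auto
  finally show ?thesis
    by (simp add: n_def v_def w_def mult_ac)
qed

section \<open>Almost commuting averages in affine actions\<close>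

text \<open>Conjugation by the translation that moves \<open>y\<close> to the origin; if
  \<open>y\<close> is fixed, the action becomes linear.\<close>

lemma cyclic_action_translate:
  assumes "cyclic_action q A"
  shows "cyclic_action q (\<lambda>s u. A s (u + y) - y)"
    and "cyclic_avg q (\<lambda>s u. A s (u + y) - y) u = cyclic_avg q A (u + y) - y"
proof -
  interpret A: cyclic_action q A by fact
  show "cyclic_action q (\<lambda>s u. A s (u + y) - y)"
  proof
    fix s
    obtain L b where L: "linear L" "\<And>x. norm (L x) \<le> norm x" and f: "\<And>x. A s x = L x + b"
      using A.nonexpansive[of s] by (auto simp: nonexpansive_affine_def)
    have "A s (u + y) - y = L u + (L y + b - y)" for u
      by (simp add: f linear_add[OF L(1)])
    with L show "nonexpansive_affine (\<lambda>u. A s (u + y) - y)"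
      unfolding nonexpansive_affine_def by blast
  qed (simp_all add: A.q A.add A.period)
  then interpret A': cyclic_action q "\<lambda>s u. A s (u + y) - y" .
  show "A'.avg u = A.avg (u + y) - y"
    by (simp add: A.avg_def A'.avg_def mean_diff mean_const[OF A.range_finite])
qed

text \<open>The interface between the geometry of the Banach space and the fixed point argument.
  Fixing \<open>0\<close> expresses that the affine maps are linear.\<close>

definition heisenberg_bound :: "'x::real_normed_vector itself \<Rightarrow> nat \<Rightarrow> real \<Rightarrow> bool" where
  "heisenberg_bound tx q \<epsilon> \<longleftrightarrow>
     (\<forall>A B Z (u :: 'x). heisenberg_action q A B Z \<longrightarrow> (\<forall>s. A s 0 = 0 \<and> B s 0 = 0 \<and> Z s 0 = 0) \<longrightarrow>
        norm (cyclic_avg q A (cyclic_avg q B (u - cyclic_avg q Z u))) \<le> \<epsilon> * norm u)"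

text \<open>The common fixed point \<open>y\<close> serves as origin. The composite of the averages
  of \<open>B\<close> and \<open>A\<close> is affine, so the difference of its two values is its
  linear part applied to \<open>x - cyclic_avg q Z x\<close>.\<close>

lemma heisenberg_affine_estimate:
  fixes A B Z :: "int \<Rightarrow> 'x::real_normed_vector \<Rightarrow> 'x"
  assumes \<epsilon>: "heisenberg_bound TYPE('x) q \<epsilon>" and heis: "heisenberg_action q A B Z"
    and y: "\<And>s. A s y = y" "\<And>s. B s y = y" "\<And>s. Z s y = y"
  shows "norm (cyclic_avg q A (cyclic_avg q B x) - cyclic_avg q A (cyclic_avg q B (cyclic_avg q Z x)))
    \<le> \<epsilon> * norm (x - y)"
proof -
  interpret heisenberg_action q A B Z by fact
  let ?t = "\<lambda>F s u. F s (u + y) - y :: 'x"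
  note tA = cyclic_action_translate[OF A.cyclic_action_axioms, of y]
  note tB = cyclic_action_translate[OF B.cyclic_action_axioms, of y]
  note tZ = cyclic_action_translate[OF Z.cyclic_action_axioms, of y]
  interpret A': cyclic_action q "?t A" by (rule tA)
  interpret B': cyclic_action q "?t B" by (rule tB)
  interpret Z': cyclic_action q "?t Z" by (rule tZ)
  have "heisenberg_action q (?t A) (?t B) (?t Z)"
    by unfold_locales (simp_all add: commutator Z_A Z_B)
  then have "norm (A'.avg (B'.avg ((x - y) - Z'.avg (x - y)))) \<le> \<epsilon> * norm (x - y)"
    using \<epsilon> y unfolding heisenberg_bound_def by simp
  moreover have "A'.avg (B'.avg ((x - y) - Z'.avg (x - y)))
      = A.avg (B.avg x) - A.avg (B.avg (Z.avg x))"
  proof -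
    obtain L b where L: "linear L" and AB: "\<And>x. A.avg (B.avg x) = L x + b"
    proof -
      obtain L b where L: "linear L" "\<And>x. A.avg x = L x + b"
        using A.avg_nonexpansive by (auto simp: nonexpansive_affine_def)
      obtain L' b' where L': "linear L'" "\<And>x. B.avg x = L' x + b'"
        using B.avg_nonexpansive by (auto simp: nonexpansive_affine_def)
      show ?thesis
        by (rule that[of "L \<circ> L'" "L b' + b"])
          (simp_all add: L L' linear_compose linear_add[OF L(1)])
    qed
    have y': "A.avg (B.avg y) = y"
      using y by (simp add: A.avg_fixed B.avg_fixed)
    show ?thesis
      using y' by (simp add: tA(2) tB(2) tZ(2) AB linear_diff[OF L] linear_add[OF L])
  qed
  ultimately show ?thesis by simp
qed

text \<open>Both products of averages are within \<open>\<epsilon> * norm (x - y)\<close> of one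
  point \<open>y\<close> fixed by the whole group, and \<open>norm (x - y)\<close> is at most
  \<open>4 * D\<close>.\<close>

lemma heisenberg_almost_commute:
  fixes A B Z :: "int \<Rightarrow> 'x::real_normed_vector \<Rightarrow> 'x"
  assumes \<epsilon>: "heisenberg_bound TYPE('x) q \<epsilon>" "0 \<le> \<epsilon>" "\<epsilon> \<le> 1 / 2" and heis: "heisenberg_action q A B Z"
    and x: "norm (cyclic_avg q A x - x) \<le> D" "norm (cyclic_avg q B x - x) \<le> D"
  shows "norm (cyclic_avg q A (cyclic_avg q B x) - cyclic_avg q B (cyclic_avg q A x)) \<le> 8 * \<epsilon> * D"
proof -
  interpret heisenberg_action q A B Z by fact
  define y where "y = A.avg (B.avg (Z.avg x))"
  have y: "A s y = y" "B s y = y" "Z s y = y" for s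
    unfolding y_def by (rule avg_avg_avg_fixed)+
  have AB: "norm (A.avg (B.avg x) - y) \<le> \<epsilon> * norm (x - y)"
    using heisenberg_affine_estimate[OF \<epsilon>(1) heis y] by (simp add: y_def)
  \<comment> \<open>For the opposite order the exchanged action with inverted centre is used; it has
    the same averages and the same fixed point.\<close>
  have "norm (B.avg (A.avg x) - B.avg (A.avg (Z.avg x))) \<le> \<epsilon> * norm (x - y)"
    using heisenberg_affine_estimate[OF \<epsilon>(1) swap y(2,1), of x] y
    by (simp add: cyclic_action_uminus[OF Z.cyclic_action_axioms])
  moreover have "B.avg (A.avg (Z.avg x)) = y"
    unfolding y_def by (rule avg_A_B_commute[symmetric]) (rule Z.A_avg)
  ultimately have BA: "norm (B.avg (A.avg x) - y) \<le> \<epsilon> * norm (x - y)"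
    by simp
  \<comment> \<open>\<open>x\<close> is within \<open>2 * D\<close> of
    \<open>A.avg (B.avg x)\<close>, which is within \<open>norm (x - y) / 2\<close> of
    \<open>y\<close>; solving for \<open>norm (x - y)\<close> gives \<open>4 * D\<close>.\<close>
  have "norm (A.avg (B.avg x) - A.avg x) \<le> D"
    using nonexpansive_affine_dist[OF A.avg_nonexpansive] x(2) by (rule order_trans)
  moreover have "norm (x - y) \<le> norm (A.avg (B.avg x) - y) + norm (A.avg (B.avg x) - A.avg x) + norm (A.avg x - x)"
    using norm_triangle_ineq4[of "A.avg (B.avg x) - y" "A.avg (B.avg x) - A.avg x + (A.avg x - x)"]
      norm_triangle_ineq[of "A.avg (B.avg x) - A.avg x" "A.avg x - x"] by (simp add: algebra_simps)
  moreover have "\<epsilon> * norm (x - y) \<le> norm (x - y) / 2"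
    using \<epsilon>(3) mult_right_mono[of \<epsilon> "1/2" "norm (x - y)"] by simp
  ultimately have "norm (x - y) \<le> 4 * D"
    using AB x(1) by linarith
  then have "\<epsilon> * norm (x - y) \<le> \<epsilon> * (4 * D)"
    using \<epsilon>(2) by (rule mult_left_mono)
  then show ?thesis
    using AB BA norm_triangle_ineq4[of "A.avg (B.avg x) - y" "B.avg (A.avg x) - y"] by simp
qed

section \<open>Fixed points of families of cyclic actions\<close>

text \<open>Displacements along the orbit of \<open>T\<close> decay geometrically and bound its
  steps, so the orbit converges by completeness; each \<open>P i\<close> is continuous and fixes the
  limit.\<close>

lemma geometric_displacement_fixed_point:
  fixes P :: "'i \<Rightarrow> 'x::banach \<Rightarrow> 'x" and T :: "'x \<Rightarrow> 'x"
  assumes \<Gamma>: "finite \<Gamma>" and P: "\<And>i x y. i \<in> \<Gamma> \<Longrightarrow> norm (P i x - P i y) \<le> norm (x - y)"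
    and c: "0 \<le> c" "c < 1"
    and move: "\<And>x D. (\<And>i. i \<in> \<Gamma> \<Longrightarrow> norm (P i x - x) \<le> D) \<Longrightarrow> norm (T x - x) \<le> D"
    and contract: "\<And>x D i. (\<And>i. i \<in> \<Gamma> \<Longrightarrow> norm (P i x - x) \<le> D) \<Longrightarrow> i \<in> \<Gamma> \<Longrightarrow> norm (P i (T x) - T x) \<le> c * D"
  shows "\<exists>x. \<forall>i\<in>\<Gamma>. P i x = x"
proof -
  \<comment> \<open>A sum instead of a maximum bounds the displacements at the starting point
    \<open>0\<close>, also for empty \<open>\<Gamma>\<close>.\<close>
  define D where "D = (\<Sum>i\<in>\<Gamma>. norm (P i 0 - 0))"
  define f where "f n = (T ^^ n) 0" for n
  have disp: "norm (P i (f n) - f n) \<le> c ^ n * D" if "i \<in> \<Gamma>" for i n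
    using that
  proof (induction n arbitrary: i)
    case 0
    then show ?case
      using member_le_sum[of i \<Gamma> "\<lambda>i. norm (P i 0 - 0)"] \<Gamma> by (simp add: f_def D_def)
  next
    case (Suc n)
    then show ?case
      using contract[OF Suc.IH Suc.prems] by (simp add: f_def mult.assoc)
  qed
  have step: "norm (f (Suc n) - f n) \<le> c ^ n * D" for n
    using move[OF disp, of n] by (simp add: f_def)
  have "summable (\<lambda>n. c ^ n * D)"
    using c by (intro summable_mult2 summable_geometric) auto
  then have "summable (\<lambda>n. f (Suc n) - f n)"
    by (rule summable_comparison_test') (rule step)
  then obtain l where "(\<lambda>n. f n - f 0) \<longlonglongrightarrow> l"
    using summable_LIMSEQ[of "\<lambda>n. f (Suc n) - f n"] by (simp only: sum_lessThan_telescope) blast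
  then have lim: "f \<longlonglongrightarrow> l + f 0"
    using tendsto_add[of "\<lambda>n. f n - f 0" l sequentially "\<lambda>_. f 0" "f 0"] by simp
  have "P i (l + f 0) = l + f 0" if i: "i \<in> \<Gamma>" for i
  proof -
    have "(\<lambda>n. norm (f n - (l + f 0))) \<longlonglongrightarrow> 0"
      by (intro tendsto_norm_zero LIM_zero lim)
    then have "(\<lambda>n. P i (f n) - P i (l + f 0)) \<longlonglongrightarrow> 0"
      by (rule Lim_null_comparison[rotated]) (simp add: P[OF i])
    moreover have "(\<lambda>n. c ^ n * D) \<longlonglongrightarrow> 0"
      using c by (intro tendsto_mult_left_zero LIMSEQ_power_zero) auto
    then have "(\<lambda>n. P i (f n) - f n) \<longlonglongrightarrow> 0"
      by (rule Lim_null_comparison[rotated]) (simp add: disp[OF i])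
    \<comment> \<open>The constant \<open>P i (l + f 0)\<close> is written as \<open>f n\<close>
      plus two null sequences.\<close>
    ultimately have "(\<lambda>n. f n + ((P i (f n) - f n) - (P i (f n) - P i (l + f 0)))) \<longlonglongrightarrow> l + f 0 + (0 - 0)"
      by (intro tendsto_add tendsto_diff lim)
    then have "(\<lambda>n. P i (l + f 0)) \<longlonglongrightarrow> l + f 0" by simp
    then show ?thesis
      by (simp add: LIMSEQ_const_iff)
  qed
  then show ?thesis by blast
qed

text \<open>In the mean of \<open>?P i (?P j x) - ?P j x\<close> over \<open>j\<close> the term
  \<open>j = i\<close> vanishes, as \<open>?P i\<close> is idempotent, and the others are at most
  \<open>(1 + 8 * \<epsilon>) * D\<close> by almost commutation. Saving one term of
  \<open>card \<Gamma>\<close> outweighs the errors when \<open>\<epsilon>\<close> is small.\<close>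

lemma heisenberg_family_fixed_point:
  fixes A :: "'i \<Rightarrow> int \<Rightarrow> 'x::banach \<Rightarrow> 'x"
  assumes \<Gamma>: "finite \<Gamma>"
    and \<epsilon>: "heisenberg_bound TYPE('x) q \<epsilon>" "0 \<le> \<epsilon>" "16 * \<epsilon> * real (card \<Gamma>) \<le> 1"
    and cyc: "\<And>i. i \<in> \<Gamma> \<Longrightarrow> cyclic_action q (A i)"
    and heis: "\<And>i j. i \<in> \<Gamma> \<Longrightarrow> j \<in> \<Gamma> \<Longrightarrow> i \<noteq> j \<Longrightarrow>
      \<exists>Z. heisenberg_action q (A i) (A j) Z \<or> heisenberg_action q (A j) (A i) Z"
  shows "\<exists>x. \<forall>i\<in>\<Gamma>. \<forall>s. A i s x = x"
proof (cases "\<Gamma> = {}")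
  case False
  let ?P = "\<lambda>i. cyclic_avg q (A i)" and ?k = "real (card \<Gamma>)"
  let ?T = "\<lambda>x. mean \<Gamma> (\<lambda>j. ?P j x)"
  have k: "?k \<ge> 1" using \<Gamma> False by (simp add: Suc_le_eq card_gt_0_iff)
  have "16 * \<epsilon> \<le> 16 * \<epsilon> * ?k" using \<epsilon>(2) k mult_left_mono[of 1 ?k "16 * \<epsilon>"] by simp
  with \<epsilon>(3) have \<epsilon>_half: "\<epsilon> \<le> 1 / 2" by linarith
  note aff = cyclic_action.avg_nonexpansive[OF cyc]
  define c where "c = (?k - 1) * (1 + 8 * \<epsilon>) / ?k"
  have "\<exists>x. \<forall>i\<in>\<Gamma>. ?P i x = x"
  proof (rule geometric_displacement_fixed_point[OF \<Gamma>, where T = ?T and c = c])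
    show "0 \<le> c" using k \<epsilon>(2) by (simp add: c_def)
    have "(?k - 1) * (1 + 8 * \<epsilon>) < ?k"
    proof -
      \<comment> \<open>The errors add up to at most \<open>1 / 2\<close>, while a whole term is
        saved.\<close>
      have "8 * \<epsilon> * (?k - 1) \<le> 1 / 2" using \<epsilon>(2,3) by (simp add: right_diff_distrib)
      then show ?thesis by (simp add: algebra_simps)
    qed
    then show "c < 1" using k by (simp add: c_def)
    show "norm (?P i x - ?P i y) \<le> norm (x - y)" if "i \<in> \<Gamma>" for i x y
      by (rule nonexpansive_affine_dist[OF aff[OF that]])
  next
    fix x D assume D: "\<And>i. i \<in> \<Gamma> \<Longrightarrow> norm (?P i x - x) \<le> D"
    have "?T x - x = mean \<Gamma> (\<lambda>j. ?P j x - x)"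
      by (simp add: mean_diff mean_const[OF \<Gamma> False])
    then show "norm (?T x - x) \<le> D"
      using norm_mean_le[OF \<Gamma> False D] by simp
    fix i assume i: "i \<in> \<Gamma>"
    interpret i: cyclic_action q "A i" by (rule cyc[OF i])
    have "D \<ge> 0" using D[OF i] norm_ge_zero order_trans by blast
    have summand: "norm (?P i (?P j x) - ?P j x) \<le> (if j = i then 0 else (1 + 8 * \<epsilon>) * D)" if j: "j \<in> \<Gamma>" for j
    proof (cases "j = i")
      case True
      then show ?thesis using i.avg_fixed[OF i.A_avg] by simp
    next
      case False
      interpret j: cyclic_action q "A j" by (rule cyc[OF j])
      \<comment> \<open>The Heisenberg action is given in one of the two orders; the estimate is
        symmetric in them.\<close>
      have "norm (?P i (?P j x) - ?P j (?P i x)) \<le> 8 * \<epsilon> * D"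
        using heis[OF i j] False heisenberg_almost_commute[OF \<epsilon>(1,2) \<epsilon>_half] D[OF i] D[OF j]
        by (metis norm_minus_commute)
      moreover have "norm (?P j (?P i x) - ?P j x) \<le> D"
        using nonexpansive_affine_dist[OF j.avg_nonexpansive] D[OF i] by (rule order_trans)
      ultimately show ?thesis
        using False norm_triangle_ineq[of "?P i (?P j x) - ?P j (?P i x)" "?P j (?P i x) - ?P j x"]
        by (simp add: algebra_simps)
    qed
    have "?P i (?T x) - ?T x = mean \<Gamma> (\<lambda>j. ?P i (?P j x) - ?P j x)"
      by (simp add: mean_diff nonexpansive_affine_mean[OF aff[OF i] \<Gamma> False])
    then have "norm (?P i (?T x) - ?T x) \<le> mean \<Gamma> (\<lambda>j. norm (?P i (?P j x) - ?P j x))"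
      by (simp add: norm_mean_le_mean)
    also have "\<dots> \<le> mean \<Gamma> (\<lambda>j. if j = i then 0 else (1 + 8 * \<epsilon>) * D)"
      by (rule mean_mono) (rule summand)
    also have "\<dots> = mean \<Gamma> (\<lambda>j. (1 + 8 * \<epsilon>) * D - (if j = i then (1 + 8 * \<epsilon>) * D else 0))"
      by (rule mean_cong) simp
    also have "\<dots> = (1 + 8 * \<epsilon>) * D - (1 + 8 * \<epsilon>) * D / ?k"
      using i \<Gamma> by (simp add: mean_diff mean_const[OF \<Gamma> False]) (simp add: mean_def)
    also have "\<dots> = c * D"
      using k by (simp add: c_def field_simps)
    finally show "norm (?P i (?T x) - ?T x) \<le> c * D" .
  qed
  then obtain x where x: "\<And>i. i \<in> \<Gamma> \<Longrightarrow> ?P i x = x" by blast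
  \<comment> \<open>Values of an average are fixed by its cyclic group.\<close>
  have "A i s x = x" if "i \<in> \<Gamma>" for i s
    using cyclic_action.A_avg[OF cyc[OF that], of s x] x[OF that] by simp
  then show ?thesis by blast
qed simp

lemma cyclic_action_trivial: "q > 0 \<Longrightarrow> cyclic_action q (\<lambda>_ x. x)"
  by unfold_locales (auto simp: nonexpansive_affine_def intro!: exI[of _ "\<lambda>x. x"] exI[of _ 0] linear_id[unfolded id_def])

section \<open>Actions of Steinberg groups\<close>

text \<open>The Steinberg relations as identities between maps, with commutators cleared of
  inverses. Injectivity makes the idempotent map at parameter zero the identity.\<close>

locale steinberg_action = cring R for R :: "('a, 'b) ring_scheme" (structure) +
  fixes n :: nat and x :: "nat \<Rightarrow> nat \<Rightarrow> 'a \<Rightarrow> 'x::real_normed_vector \<Rightarrow> 'x"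
  assumes x_nonexpansive: "(i, j, s) \<in> steinberg_gens n R \<Longrightarrow> nonexpansive_affine (x i j s)"
    and x_inj: "(i, j, s) \<in> steinberg_gens n R \<Longrightarrow> inj (x i j s)"
    and x_add: "(i, j, s) \<in> steinberg_gens n R \<Longrightarrow> (i, j, t) \<in> steinberg_gens n R \<Longrightarrow>
      x i j (s \<oplus> t) p = x i j s (x i j t p)"
    and x_commute: "(i, j, s) \<in> steinberg_gens n R \<Longrightarrow> (k, l, t) \<in> steinberg_gens n R \<Longrightarrow>
      i \<noteq> l \<Longrightarrow> j \<noteq> k \<Longrightarrow> x i j s (x k l t p) = x k l t (x i j s p)"
    and x_mult: "(i, j, s) \<in> steinberg_gens n R \<Longrightarrow> (j, l, t) \<in> steinberg_gens n R \<Longrightarrow>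
      i \<noteq> l \<Longrightarrow> x i j s (x j l t p) = x i l (s \<otimes> t) (x j l t (x i j s p))"
begin

lemma x_zero:
  assumes "i \<in> {1..n}" "j \<in> {1..n}" "i \<noteq> j"
  shows "x i j \<zero> p = p"
proof -
  have g: "(i, j, \<zero>) \<in> steinberg_gens n R"
    using assms by (simp add: steinberg_gens_def)
  have "x i j \<zero> (x i j \<zero> p) = x i j \<zero> p"
    using x_add[OF g g, of p] by simp
  then show ?thesis
    using x_inj[OF g] by (simp add: inj_eq)
qed

text \<open>\<open>e\<close> will be the reduction of integers to the prime field, so this is the
  root subgroup of scalar multiples of \<open>\<tau>\<close>, parametrised by integers as
  \<open>cyclic_action\<close> requires.\<close>

definition one_param :: "(int \<Rightarrow> 'a) \<Rightarrow> nat \<Rightarrow> nat \<Rightarrow> 'a \<Rightarrow> int \<Rightarrow> 'x \<Rightarrow> 'x" where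
  "one_param e i j \<tau> s = x i j (e s \<otimes> \<tau>)"

context
  fixes q :: nat and e :: "int \<Rightarrow> 'a"
  assumes q: "q > 0"
    and e_closed: "e s \<in> carrier R"
    and e_add: "e (s + t) = e s \<oplus> e t"
    and e_mult: "e (s * t) = e s \<otimes> e t"
    and e_period: "e (int q) = \<zero>"
begin

lemma cyclic_action_one_param:
  assumes "i \<in> {1..n}" "j \<in> {1..n}" "i \<noteq> j" "\<tau> \<in> carrier R"
  shows "cyclic_action q (one_param e i j \<tau>)"
proof
  have g: "(i, j, e s \<otimes> \<tau>) \<in> steinberg_gens n R" for s
    using assms e_closed by (simp add: steinberg_gens_def)
  fix s t p
  show "nonexpansive_affine (one_param e i j \<tau> s)"
    unfolding one_param_def by (rule x_nonexpansive[OF g])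
  show "one_param e i j \<tau> (s + t) p = one_param e i j \<tau> s (one_param e i j \<tau> t p)"
    using x_add[OF g g] assms(4) by (simp add: one_param_def e_add l_distr e_closed)
  show "one_param e i j \<tau> (int q) p = p"
    using assms by (simp add: one_param_def e_period x_zero)
qed (rule q)

lemma heisenberg_one_param_commute:
  assumes ij: "i \<in> {1..n}" "j \<in> {1..n}" "i \<noteq> j" "\<tau> \<in> carrier R"
    and kl: "k \<in> {1..n}" "l \<in> {1..n}" "k \<noteq> l" "\<sigma> \<in> carrier R"
    and "i \<noteq> l" "j \<noteq> k"
  shows "heisenberg_action q (one_param e i j \<tau>) (one_param e k l \<sigma>) (\<lambda>_ p. p)"
proof -
  interpret A: cyclic_action q "one_param e i j \<tau>" by (rule cyclic_action_one_param[OF ij])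
  interpret B: cyclic_action q "one_param e k l \<sigma>" by (rule cyclic_action_one_param[OF kl])
  interpret Z: cyclic_action q "\<lambda>_ p. p :: 'x" by (rule cyclic_action_trivial[OF q])
  show ?thesis
  proof
    show "one_param e i j \<tau> s (one_param e k l \<sigma> t p) = one_param e k l \<sigma> t (one_param e i j \<tau> s p)" for s t p
      using assms unfolding one_param_def by (intro x_commute) (auto simp: steinberg_gens_def e_closed)
  qed simp_all
qed

lemma heisenberg_one_param_mult:
  assumes ij: "i \<in> {1..n}" "j \<in> {1..n}" "i \<noteq> j" "\<tau> \<in> carrier R"
    and jl: "j \<in> {1..n}" "l \<in> {1..n}" "j \<noteq> l" "\<sigma> \<in> carrier R"
    and il: "i \<noteq> l"
  shows "heisenberg_action q (one_param e i j \<tau>) (one_param e j l \<sigma>) (one_param e i l (\<tau> \<otimes> \<sigma>))"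
proof -
  interpret A: cyclic_action q "one_param e i j \<tau>" by (rule cyclic_action_one_param[OF ij])
  interpret B: cyclic_action q "one_param e j l \<sigma>" by (rule cyclic_action_one_param[OF jl])
  interpret Z: cyclic_action q "one_param e i l (\<tau> \<otimes> \<sigma>)"
    using assms by (intro cyclic_action_one_param) auto
  note gens = steinberg_gens_def e_closed
  show ?thesis
  proof
    fix s t p
    have "e s \<otimes> \<tau> \<otimes> (e t \<otimes> \<sigma>) = e (s * t) \<otimes> (\<tau> \<otimes> \<sigma>)"
      using assms by (simp add: e_mult e_closed m_ac)
    then show "one_param e i j \<tau> s (one_param e j l \<sigma> t p)
        = one_param e i l (\<tau> \<otimes> \<sigma>) (s * t) (one_param e j l \<sigma> t (one_param e i j \<tau> s p))"
      using assms x_mult[of i j "e s \<otimes> \<tau>" l "e t \<otimes> \<sigma>"] by (simp add: one_param_def gens)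
    show "one_param e i l (\<tau> \<otimes> \<sigma>) s (one_param e i j \<tau> t p) = one_param e i j \<tau> t (one_param e i l (\<tau> \<otimes> \<sigma>) s p)"
      using assms unfolding one_param_def by (intro x_commute) (auto simp: gens)
    show "one_param e i l (\<tau> \<otimes> \<sigma>) s (one_param e j l \<sigma> t p) = one_param e j l \<sigma> t (one_param e i l (\<tau> \<otimes> \<sigma>) s p)"
      using assms unfolding one_param_def by (intro x_commute) (auto simp: gens)
  qed
qed

text \<open>\<open>nx\<close> is the successor on the cycle of indices. As \<open>n \<ge> 3\<close>,
  two indices are never successors of each other, which excludes opposite roots, the pairs on whose
  commutator the relations say nothing.\<close>

lemma one_param_pair:
  assumes n: "n \<ge> 3" and i: "i \<in> {1..n}" and k: "k \<in> {1..n}"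
    and \<tau>: "\<tau> \<in> carrier R" and \<sigma>: "\<sigma> \<in> carrier R"
  defines "nx \<equiv> \<lambda>i. if i = n then 1 else Suc i"
  shows "\<exists>Z. heisenberg_action q (one_param e i (nx i) \<tau>) (one_param e k (nx k) \<sigma>) Z
    \<or> heisenberg_action q (one_param e k (nx k) \<sigma>) (one_param e i (nx i) \<tau>) Z"
proof -
  have nxs: "nx i \<in> {1..n}" "nx i \<noteq> i" "nx k \<in> {1..n}" "nx k \<noteq> k"
    using n i k by (auto simp: nx_def)
  have "nx i \<noteq> k \<or> nx k \<noteq> i"
    using n i k by (auto simp: nx_def split: if_splits)
  then consider "nx i = k" "nx k \<noteq> i" | "nx k = i" "nx i \<noteq> k" | "nx i \<noteq> k" "nx k \<noteq> i"
    by blast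
  then show ?thesis
  proof cases
    case 1
    then show ?thesis
      using heisenberg_one_param_mult[of i k \<tau> "nx k" \<sigma>] i k nxs \<tau> \<sigma> by auto
  next
    case 2
    then show ?thesis
      using heisenberg_one_param_mult[of k i \<sigma> "nx i" \<tau>] i k nxs \<tau> \<sigma> by auto
  next
    case 3
    then show ?thesis
      using heisenberg_one_param_commute[of i "nx i" \<tau> k "nx k" \<sigma>] i k nxs \<tau> \<sigma> by auto
  qed
qed

end

section \<open>Root elements fixing a point\<close>

definition stab :: "'x \<Rightarrow> nat \<Rightarrow> nat \<Rightarrow> 'a set" where
  "stab p i j = {s \<in> carrier R. x i j s p = p}"

lemma stab_add:
  "i \<in> {1..n} \<Longrightarrow> j \<in> {1..n} \<Longrightarrow> i \<noteq> j \<Longrightarrow> s \<in> stab p i j \<Longrightarrow> t \<in> stab p i j \<Longrightarrow> s \<oplus> t \<in> stab p i j"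
  using x_add[of i j s t p] by (simp add: stab_def steinberg_gens_def)

lemma stab_mult:
  assumes "i \<in> {1..n}" "j \<in> {1..n}" "l \<in> {1..n}" "i \<noteq> j" "j \<noteq> l" "i \<noteq> l"
    and "s \<in> stab p i j" "t \<in> stab p j l"
  shows "s \<otimes> t \<in> stab p i l"
  using assms x_mult[of i j s l t p] by (simp add: stab_def steinberg_gens_def)

text \<open>The pair \<open>(i, j)\<close> is reached by walking along the cycle of indices, where
  exactly one factor carries \<open>s\<close> and all others carry \<open>\<one>\<close>.\<close>

lemma stab_all:
  assumes one: "\<And>i. i \<in> {1..<n} \<Longrightarrow> \<one> \<in> stab p i (Suc i)" "\<one> \<in> stab p n 1"
    and s: "\<And>i. i \<in> {1..<n} \<Longrightarrow> s \<in> stab p i (Suc i)" "s \<in> stab p n 1"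
    and ij: "i \<in> {1..n}" "j \<in> {1..n}" "i \<noteq> j"
  shows "s \<in> stab p i j"
proof -
  have up: "u \<in> stab p i j" if "i < j" "1 \<le> i" "j \<le> n" "\<And>i. i \<in> {1..<n} \<Longrightarrow> u \<in> stab p i (Suc i)" for u i j
    using that
  proof (induction j rule: less_induct)
    case (less j)
    show ?case
    proof (cases "j = Suc i")
      case True
      then show ?thesis using less.prems by simp
    next
      case False
      then obtain j' where j: "j = Suc j'" "i < j'"
        using less.prems(1) by (metis less_antisym not_less_eq old.nat.exhaust not_less0)
      have "u \<otimes> \<one> \<in> stab p i j"
        using less j one by (intro stab_mult[where j = j']) auto
      moreover have "u \<in> carrier R"
        using less.prems(4)[of i] less.prems by (auto simp: stab_def)
      ultimately show ?thesis by simp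
    qed
  qed
  have car: "s \<in> carrier R" using s by (simp add: stab_def)
  \<comment> \<open>Walk up to \<open>n\<close> with \<open>\<one>\<close>, then close the cycle
    with \<open>s\<close>.\<close>
  have to_1: "s \<in> stab p i 1" if "1 < i" "i \<le> n" for i
  proof (cases "i = n")
    case False
    then have "\<one> \<otimes> s \<in> stab p i 1"
      using that s one up[of i n \<one>] by (intro stab_mult[where j = n]) auto
    with car show ?thesis by simp
  qed (use s in simp)
  show ?thesis
  proof (cases "i < j")
    case True
    show ?thesis by (rule up[OF True]) (use ij s in auto)
  next
    case False
    show ?thesis
    proof (cases "j = 1")
      case True
      with False ij to_1[of i] show ?thesis by simp
    next
      \<comment> \<open>For \<open>1 < j < i\<close> the walk passes through \<open>1\<close>, with
        \<open>s\<close> before it and \<open>\<one>\<close> after it.\<close>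
      case j: False
      then have "s \<otimes> \<one> \<in> stab p i j"
        using False ij one to_1[of i] up[of 1 j \<one>] by (intro stab_mult[where j = 1]) auto
      with car show ?thesis by simp
    qed
  qed
qed

end

section \<open>Constants and variables of the polynomial ring\<close>

context cring
begin

lemma indexed_const_add:
  "a \<in> carrier R \<Longrightarrow> b \<in> carrier R \<Longrightarrow>
    indexed_padd (indexed_const a) (indexed_const b) = indexed_const (a \<oplus> b)"
  by (auto simp: indexed_padd_def indexed_const_def)

lemma indexed_const_mult:
  "a \<in> carrier R \<Longrightarrow> b \<in> carrier R \<Longrightarrow>
    indexed_mult (indexed_const a) (indexed_const b) = indexed_const (a \<otimes> b)"
  by (subst indexed_mult_const) (auto simp: carrier_coeff_def indexed_const_def)

text \<open>Identifies the ring product with a variable with the inductive step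
  \<open>indexed_pmult\<close> of \<open>indexed_pset\<close>.\<close>

lemma indexed_mult_indexed_var:
  fixes P :: "'i multiset \<Rightarrow> 'a"
  assumes "carrier_coeff P"
  shows "indexed_mult P (indexed_pmult (indexed_const \<one>) i) = indexed_pmult P i"
proof -
  have "indexed_mult P (indexed_const \<one>) = P"
    using assms by (auto simp: indexed_mult_const carrier_coeff_def)
  moreover have "carrier_coeff (indexed_const \<one> :: 'i multiset \<Rightarrow> 'a)"
    by (simp add: carrier_coeff_def indexed_const_def)
  ultimately show ?thesis
    using indexed_mult_var[OF assms] by simp
qed

end

section \<open>Fixed points for Steinberg relations over polynomial rings\<close>

text \<open>The family has one root subgroup for each of \<open>n\<close> cyclic edges and each of
  \<open>1\<close> and the variables, hence \<open>n * Suc (card I)\<close> members. Its fixed point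
  is fixed by all generators, since constants and variables generate the polynomials and commutators
  realise products.\<close>

lemma steinberg_action_poly_fixed_point:
  fixes x :: "nat \<Rightarrow> nat \<Rightarrow> ('i multiset \<Rightarrow> int) \<Rightarrow> 'x::banach \<Rightarrow> 'x"
  assumes n: "n \<ge> 3" and I: "finite I" and q: "q > 1"
    and \<epsilon>: "heisenberg_bound TYPE('x) q \<epsilon>" "0 \<le> \<epsilon>" "16 * \<epsilon> * real (n * Suc (card I)) \<le> 1"
    and st: "steinberg_action (indexed_poly_ring (residue_ring (int q)) I) n x"
  shows "\<exists>p. \<forall>(i, j, s)\<in>steinberg_gens n (indexed_poly_ring (residue_ring (int q)) I). x i j s p = p"
proof -
  let ?F = "residue_ring (int q)" and ?R = "indexed_poly_ring (residue_ring (int q)) I"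
  interpret F: residues "int q" ?F
    using q by unfold_locales auto
  interpret St: steinberg_action ?R n x by fact
  have R: "carrier ?R = F.indexed_pset I (carrier ?F)" "add ?R = F.indexed_padd" "mult ?R = F.indexed_mult"
    "\<one>\<^bsub>?R\<^esub> = F.indexed_const \<one>\<^bsub>?F\<^esub>" "\<zero>\<^bsub>?R\<^esub> = F.indexed_const \<zero>\<^bsub>?F\<^esub>"
    by (simp_all add: indexed_poly_ring_def)
  have coeff: "F.carrier_coeff P" if "P \<in> carrier ?R" for P
    by (rule F.indexed_pset_in_carrier[OF subset_refl that[unfolded R]])
  have mod_F: "s mod int q \<in> carrier ?F" for s
    using F.mod_in_carrier .
  define e :: "int \<Rightarrow> 'i multiset \<Rightarrow> int" where "e s = F.indexed_const (s mod int q)" for s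
  \<comment> \<open>\<open>None\<close> stands for the constant \<open>1\<close>,
    \<open>Some i\<close> for the variable with index \<open>i\<close>.\<close>
  define \<tau> where "\<tau> k = (case k of None \<Rightarrow> \<one>\<^bsub>?R\<^esub> | Some i \<Rightarrow> F.indexed_pmult \<one>\<^bsub>?R\<^esub> i)" for k :: "'i option"
  have e_closed: "e s \<in> carrier ?R" for s
    unfolding R e_def by (intro F.indexed_pset.indexed_const mod_F)
  have e_add: "e (s + t) = e s \<oplus>\<^bsub>?R\<^esub> e t" for s t
    unfolding R e_def by (simp add: F.indexed_const_add[OF mod_F mod_F] F.res_add_eq mod_add_eq)
  have e_mult: "e (s * t) = e s \<otimes>\<^bsub>?R\<^esub> e t" for s t
    unfolding R e_def by (simp add: F.indexed_const_mult[OF mod_F mod_F] F.res_mult_eq mod_mult_eq)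
  have e_period: "e (int q) = \<zero>\<^bsub>?R\<^esub>"
    unfolding R e_def by (simp add: F.res_zero_eq)
  have e_one: "e 1 = \<one>\<^bsub>?R\<^esub>"
    unfolding R e_def using q by (simp add: F.res_one_eq)
  have q0: "q > 0" using q by simp
  let ?J = "insert None (Some ` I)"
  have \<tau>_closed: "\<tau> k \<in> carrier ?R" if "k \<in> ?J" for k
    using that St.one_closed unfolding \<tau>_def R by (auto intro!: F.indexed_pset.indexed_pmult)
  let ?next = "\<lambda>i. if i = n then 1 else Suc i"
  let ?A = "\<lambda>(i, k). St.one_param e i (?next i) (\<tau> k)"
  let ?\<Gamma> = "{1..n} \<times> ?J"
  have "\<exists>p. \<forall>g\<in>?\<Gamma>. \<forall>s. ?A g s p = p"
  proof (rule heisenberg_family_fixed_point[OF _ \<epsilon>(1,2)])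
    show "16 * \<epsilon> * real (card ?\<Gamma>) \<le> 1"
      using \<epsilon>(3) I by (simp add: card_cartesian_product card_image)
    show "cyclic_action q (?A g)" if "g \<in> ?\<Gamma>" for g
      using that n \<tau>_closed
      by (auto intro!: St.cyclic_action_one_param[OF q0 e_closed e_add e_mult e_period] split: if_splits)
    show "\<exists>Z. heisenberg_action q (?A g) (?A h) Z \<or> heisenberg_action q (?A h) (?A g) Z"
      if "g \<in> ?\<Gamma>" "h \<in> ?\<Gamma>" for g h
      using that n \<tau>_closed St.one_param_pair[OF q0 e_closed e_add e_mult e_period n, of "fst g" "fst h" "\<tau> (snd g)" "\<tau> (snd h)"]
      by (auto simp: case_prod_beta)
  qed (use I in simp)
  then obtain p where p: "\<And>i k s. i \<in> {1..n} \<Longrightarrow> k \<in> ?J \<Longrightarrow> x i (?next i) (e s \<otimes>\<^bsub>?R\<^esub> \<tau> k) p = p"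
    by (force simp: St.one_param_def)
  have scalar: "e s \<otimes>\<^bsub>?R\<^esub> \<tau> None = e s" for s
    using e_closed by (simp add: \<tau>_def)
  \<comment> \<open>\<open>None\<close> yields the constants \<open>e s\<close>, and the parameter
    \<open>1\<close> yields \<open>\<tau> k\<close> itself.\<close>
  have edge: "e s \<in> St.stab p i (?next i)" "\<tau> k \<in> St.stab p i (?next i)" if "i \<in> {1..n}" "k \<in> ?J" for i k s
    using p[OF that(1), of None s] p[OF that, of 1] e_closed \<tau>_closed[OF that(2)]
    by (simp_all add: St.stab_def scalar e_one)
  have all: "s \<in> St.stab p i j" if "i \<in> {1..n}" "j \<in> {1..n}" "i \<noteq> j" "\<And>i. i \<in> {1..n} \<Longrightarrow> s \<in> St.stab p i (?next i)" for i j s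
  proof (rule St.stab_all[OF _ _ _ _ that(1-3)])
    show "\<one>\<^bsub>?R\<^esub> \<in> St.stab p i (Suc i)" "s \<in> St.stab p i (Suc i)" if "i \<in> {1..<n}" for i
      using edge(1)[of i None 1] \<open>\<And>i. i \<in> {1..n} \<Longrightarrow> s \<in> St.stab p i (?next i)\<close>[of i] that
      by (simp_all add: e_one)
    show "\<one>\<^bsub>?R\<^esub> \<in> St.stab p n 1" "s \<in> St.stab p n 1"
      using edge(1)[of n None 1] that(4)[of n] n by (simp_all add: e_one)
  qed
  have "P \<in> St.stab p i j" if "P \<in> F.indexed_pset I (carrier ?F)" "i \<in> {1..n}" "j \<in> {1..n}" "i \<noteq> j" for P i j
    using that
  proof (induction arbitrary: i j)
    case (indexed_const k)
    then have "F.indexed_const k = e k"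
      by (simp add: e_def F.res_carrier_eq)
    with all[OF indexed_const.prems] edge(1)[of _ None] show ?case by simp
  next
    case (indexed_padd P Q)
    then show ?case using St.stab_add[of i j P p Q] by (simp add: R)
  next
    case (indexed_pmult P k)
    \<comment> \<open>A third index \<open>l\<close>, in range because \<open>n \<ge> 3\<close>:
      \<open>P\<close> at \<open>(i, l)\<close> and the variable at \<open>(l, j)\<close> have their
      product at \<open>(i, j)\<close>.\<close>
    have "\<exists>l\<in>{1, 2, 3}. l \<noteq> i \<and> l \<noteq> j" by auto
    then obtain l where "l \<in> {1, 2, 3}" and l: "l \<noteq> i" "l \<noteq> j" by blast
    with n have "l \<in> {1..n}" by auto
    note l = this l
    have k: "Some k \<in> ?J" using indexed_pmult.hyps(2) by auto
    have "P \<otimes>\<^bsub>?R\<^esub> \<tau> (Some k) \<in> St.stab p i j"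
      using l indexed_pmult.prems indexed_pmult.IH all[of l j "\<tau> (Some k)"] edge(2)[of _ "Some k"] k
      by (intro St.stab_mult[where j = l]) auto
    moreover have "P \<otimes>\<^bsub>?R\<^esub> \<tau> (Some k) = F.indexed_pmult P k"
      using k indexed_pmult.hyps(1) coeff[of P] F.indexed_mult_indexed_var[of P k] by (simp add: \<tau>_def R)
    ultimately show ?case by simp
  qed
  then have "\<forall>(i, j, s)\<in>steinberg_gens n ?R. x i j s p = p"
    by (auto simp: steinberg_gens_def St.stab_def R)
  then show ?thesis by blast
qed

section \<open>From isometric actions of the presented group to the relations\<close>

lemma nonexpansive_affine_complex:
  assumes "complex_affine f" "\<And>x y. dist (f x) (f y) = dist x y"
  shows "nonexpansive_affine f"
proof -
  obtain L b where L: "complex_linear L" and f: "\<And>x. f x = L x + b"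
    using assms(1) by (auto simp: complex_affine_def)
  have "linear L"
    using L by (intro linearI) (simp_all add: complex_linear_def scaleR_scaleC)
  moreover have "norm (L x) \<le> norm x" for x
    using assms(2)[of x 0] linear_0[OF \<open>linear L\<close>] by (simp add: f dist_norm)
  ultimately show ?thesis
    using f unfolding nonexpansive_affine_def by blast
qed

text \<open>\<open>\<rho>\<close> evaluates words through \<open>\<phi>\<close>, which turns the
  defining relations into identities of maps; a point fixed by all letters is fixed by all
  words.\<close>

lemma steinberg_action_of_group_action:
  fixes \<phi> :: "_ \<Rightarrow> 'x::real_normed_vector \<Rightarrow> 'x"
  assumes R: "cring R" and \<phi>: "group_action (steinberg_group n R) UNIV \<phi>"
    and aff: "\<And>g. g \<in> carrier (steinberg_group n R) \<Longrightarrow> nonexpansive_affine (\<phi> g)"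
  defines "\<rho> \<equiv> \<lambda>w. \<phi> (word_rel (steinberg_gens n R) (steinberg_rels n R) `` {w})"
  shows "steinberg_action R n (\<lambda>i j s. \<rho> [((i, j, s), True)])"
    and "(\<And>i j s. (i, j, s) \<in> steinberg_gens n R \<Longrightarrow> \<rho> [((i, j, s), True)] p = p) \<Longrightarrow>
      g \<in> carrier (steinberg_group n R) \<Longrightarrow> \<phi> g p = p"
proof -
  let ?S = "steinberg_gens n R" and ?Rel = "steinberg_rels n R" and ?G = "steinberg_group n R"
  interpret group_action ?G UNIV \<phi> by fact
  have car: "g \<in> carrier ?G \<longleftrightarrow> (\<exists>w\<in>words ?S. g = word_rel ?S ?Rel `` {w})" for g
    by (auto simp: steinberg_group_def presented_group_def quotient_def)
  have Nil: "\<rho> [] p = p" for p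
    using fun_cong[OF id_eq_one, of p] by (simp add: \<rho>_def steinberg_group_def presented_group_def)
  have append: "\<rho> (u @ v) p = \<rho> u (\<rho> v p)" if "u \<in> words ?S" "v \<in> words ?S" for u v p
    using that composition_rule[of p "word_rel ?S ?Rel `` {u}" "word_rel ?S ?Rel `` {v}"]
      presented_group_mult[OF that, of ?Rel] car by (auto simp: \<rho>_def steinberg_group_def)
  have rel: "\<rho> u = \<rho> v" if "(u, v) \<in> word_rel ?S ?Rel" for u v
    using equiv_class_eq[OF equiv_word_rel that] by (simp add: \<rho>_def)
  have cons: "\<rho> (g # w) p = \<rho> [g] (\<rho> w p)" if "fst g \<in> ?S" "w \<in> words ?S" for g w p
    using append[of "[g]" w] that by simp
  have relator: "\<rho> u = \<rho> v" if "(u, v) \<in> ?Rel" "u \<in> words ?S" "v \<in> words ?S" for u v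
    using rel[OF word_rel.rel[OF _ _ that, of "[]" "[]"]] by simp
  have inv: "\<rho> [(g, e)] (\<rho> [(g, \<not> e)] p) = p" if "g \<in> ?S" for g e p
    using rel[OF word_rel.cancel[of "[]" ?S "[]" g e ?Rel]] that cons[of "(g, e)" "[(g, \<not> e)]" p]
    by (simp add: Nil)
  \<comment> \<open>The relation a b a^-1 b^-1 = w, applied to b a p, reads a b p = w b a p.\<close>
  have comm: "\<rho> [(a, True)] (\<rho> [(b, True)] p) = \<rho> w (\<rho> [(b, True)] (\<rho> [(a, True)] p))"
    if "(commutator_word a b, w) \<in> ?Rel" "a \<in> ?S" "b \<in> ?S" "w \<in> words ?S" for a b w p
  proof -
    have "\<rho> w (\<rho> [(b, True)] (\<rho> [(a, True)] p))
        = \<rho> (commutator_word a b) (\<rho> [(b, True)] (\<rho> [(a, True)] p))"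
      using relator[OF that(1)] that by (simp add: commutator_word_def)
    also have "\<dots> = \<rho> [(a, True)] (\<rho> [(b, True)] p)"
      using that inv[of a False] inv[of b False]
      by (simp add: commutator_word_def cons[of _ "_ # _"])
    finally show ?thesis ..
  qed
  interpret cring R by fact
  show "steinberg_action R n (\<lambda>i j s. \<rho> [((i, j, s), True)])"
  proof
    fix i j s assume ijs: "(i, j, s) \<in> ?S"
    show "nonexpansive_affine (\<rho> [((i, j, s), True)])"
      unfolding \<rho>_def using ijs by (intro aff) (auto simp: car)
    show "inj (\<rho> [((i, j, s), True)])"
      using inv[OF ijs, of False] by (intro inj_on_inverseI[where g = "\<rho> [((i, j, s), False)]"]) simp
    fix p
    show "\<rho> [((i, j, s \<oplus>\<^bsub>R\<^esub> t), True)] p = \<rho> [((i, j, s), True)] (\<rho> [((i, j, t), True)] p)"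
      if ijt: "(i, j, t) \<in> ?S" for t
    proof -
      have "([((i, j, s), True), ((i, j, t), True)], [((i, j, s \<oplus>\<^bsub>R\<^esub> t), True)]) \<in> ?Rel"
        unfolding steinberg_rels_def using ijs ijt by blast
      moreover have "(i, j, s \<oplus>\<^bsub>R\<^esub> t) \<in> ?S"
        using ijs ijt by (simp add: steinberg_gens_def)
      ultimately show ?thesis
        using relator cons[of "((i, j, s), True)" "[((i, j, t), True)]" p] ijs ijt by simp
    qed
    show "\<rho> [((i, j, s), True)] (\<rho> [((k, l, t), True)] p) = \<rho> [((k, l, t), True)] (\<rho> [((i, j, s), True)] p)"
      if klt: "(k, l, t) \<in> ?S" and "i \<noteq> l" "j \<noteq> k" for k l t
    proof -
      have "(commutator_word (i, j, s) (k, l, t), []) \<in> ?Rel"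
        unfolding steinberg_rels_def using ijs that by blast
      from comm[OF this ijs klt] show ?thesis by (simp add: Nil)
    qed
    show "\<rho> [((i, j, s), True)] (\<rho> [((j, l, t), True)] p)
        = \<rho> [((i, l, s \<otimes>\<^bsub>R\<^esub> t), True)] (\<rho> [((j, l, t), True)] (\<rho> [((i, j, s), True)] p))"
      if jlt: "(j, l, t) \<in> ?S" and "i \<noteq> l" for l t
    proof -
      have "(commutator_word (i, j, s) (j, l, t), [((i, l, s \<otimes>\<^bsub>R\<^esub> t), True)]) \<in> ?Rel"
        unfolding steinberg_rels_def using ijs that by blast
      moreover have "(i, l, s \<otimes>\<^bsub>R\<^esub> t) \<in> ?S"
        using ijs that by (simp add: steinberg_gens_def)
      ultimately show ?thesis using comm ijs jlt by simp
    qed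
  qed
  assume fix_gens: "\<And>i j s. (i, j, s) \<in> ?S \<Longrightarrow> \<rho> [((i, j, s), True)] p = p"
  have letter: "\<rho> [(g, e)] p = p" if "g \<in> ?S" for g e
  proof -
    have "\<rho> [(g, True)] p = p" using fix_gens that by (cases g) auto
    with inv[OF that, of False p] show ?thesis by (cases e) auto
  qed
  have word: "\<rho> w p = p" if "w \<in> words ?S" for w
    using that
  proof (induction w)
    case (Cons g w)
    then show ?case using cons[of g w p] letter[of "fst g" "snd g"] by simp
  qed (rule Nil)
  show "\<phi> g p = p" if "g \<in> carrier ?G"
    using that word unfolding car by (auto simp: \<rho>_def)
qed

section \<open>Choice of the threshold for q and conclusion\<close>

theorem theorem1p11:
  fixes p1 p2 :: real and n m :: nat
  assumes "1 < p1" and "p1 \<le> 2" and "2 \<le> p2" and "1 / p1 - 1 / p2 < 1 / 4"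
    and "gaussian_type TYPE('x::complex_banach) p1"
    and "gaussian_cotype TYPE('x) p2"
    and "n \<ge> 3" and "m \<ge> 1"
  shows "\<exists>q0::nat. \<forall>q::nat. Factorial_Ring.prime q \<longrightarrow> q0 \<le> q \<longrightarrow>
    (let St = steinberg_group n (indexed_poly_ring (residue_ring (int q)) {1..m})
     in property_F TYPE('x) St (discrete_topology (carrier St)))"
proof -
  obtain K where K: "K \<ge> 0" "orthogonal_bound TYPE('x) p1 p2 K"
    using type_cotype_orthogonal_bound[OF assms(5,6)] .
  define \<epsilon> where "\<epsilon> q = 2 * K * real q powr (2 * (1 / p1 - 1 / p2) - 1 / 2)" for q :: nat
  \<comment> \<open>The hypothesis on \<open>p1\<close> and \<open>p2\<close> says precisely that
    the exponent is negative.\<close>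
  have "(\<lambda>q. real q powr (2 * (1 / p1 - 1 / p2) - 1 / 2)) \<longlonglongrightarrow> 0"
    using assms(4) by (intro tendsto_neg_powr filterlim_real_sequentially) simp
  then have "(\<lambda>q. 16 * (2 * K * real q powr (2 * (1 / p1 - 1 / p2) - 1 / 2)) * real (n * Suc m)) \<longlonglongrightarrow> 16 * (2 * K * 0) * real (n * Suc m)"
    by (intro tendsto_intros)
  then have "\<forall>\<^sub>F q in sequentially. 16 * \<epsilon> q * real (n * Suc m) < 1"
    unfolding \<epsilon>_def by (rule order_tendstoD) simp
  \<comment> \<open>\<open>n * Suc m\<close> counts the root subgroups of the family, so from
    \<open>q0\<close> on the smallness condition of the fixed point argument holds.\<close>
  then obtain q0 where q0: "\<And>q. q0 \<le> q \<Longrightarrow> 16 * \<epsilon> q * real (n * Suc m) < 1"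
    by (auto simp: eventually_sequentially)
  show ?thesis
  proof (intro exI[of _ q0] allI impI)
    fix q :: nat assume q: "Factorial_Ring.prime q" "q0 \<le> q"
    let ?R = "indexed_poly_ring (residue_ring (int q)) {1..m}"
    have q1: "q > 1" using q(1) by (rule prime_gt_1_nat)
    interpret F: residues "int q" "residue_ring (int q)"
      using q1 by unfold_locales auto
    have R: "cring ?R" by (rule F.cring_indexed_poly_ring)
    have bound: "heisenberg_bound TYPE('x) q (\<epsilon> q)"
      unfolding heisenberg_bound_def \<epsilon>_def
    proof (intro allI impI)
      fix A B Z :: "int \<Rightarrow> 'x \<Rightarrow> 'x" and u :: 'x
      assume "heisenberg_action q A B Z" and "\<forall>s. A s 0 = 0 \<and> B s 0 = 0 \<and> Z s 0 = 0"
      then show "norm (cyclic_avg q A (cyclic_avg q B (u - cyclic_avg q Z u)))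
          \<le> 2 * K * real q powr (2 * (1 / p1 - 1 / p2) - 1 / 2) * norm u"
        using assms(1,3) by (intro heisenberg_linear_estimate[OF K(2,1) q(1)]) simp_all
    qed
    show "let St = steinberg_group n ?R in property_F TYPE('x) St (discrete_topology (carrier St))"
      unfolding Let_def property_F_def
    proof (intro allI impI)
      fix \<phi> :: "_ \<Rightarrow> 'x \<Rightarrow> 'x"
      assume \<phi>: "affine_isometric_action (steinberg_group n ?R) (discrete_topology (carrier (steinberg_group n ?R))) \<phi>"
      then have act: "group_action (steinberg_group n ?R) UNIV \<phi>"
        and aff: "\<And>g. g \<in> carrier (steinberg_group n ?R) \<Longrightarrow> nonexpansive_affine (\<phi> g)"
        by (auto simp: affine_isometric_action_def intro: nonexpansive_affine_complex)
      let ?x = "\<lambda>i j s. \<phi> (word_rel (steinberg_gens n ?R) (steinberg_rels n ?R) `` {[((i, j, s), True)]})"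
      have st: "steinberg_action ?R n ?x"
        by (rule steinberg_action_of_group_action(1)[OF R act]) (rule aff)
      have "0 \<le> \<epsilon> q" "16 * \<epsilon> q * real (n * Suc (card {1..m})) \<le> 1"
        using K(1) q0[OF q(2)] by (simp_all add: \<epsilon>_def)
      from steinberg_action_poly_fixed_point[OF assms(7) finite_atLeastAtMost q1 bound this st]
      obtain p where p: "\<forall>(i, j, s)\<in>steinberg_gens n ?R. ?x i j s p = p" ..
      show "\<exists>p. \<forall>g\<in>carrier (steinberg_group n ?R). \<phi> g p = p"
      proof (intro exI ballI)
        fix g assume g: "g \<in> carrier (steinberg_group n ?R)"
        show "\<phi> g p = p"
        proof (rule steinberg_action_of_group_action(2)[OF R act])
          show "?x i j s p = p" if "(i, j, s) \<in> steinberg_gens n ?R" for i j s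
            using bspec[OF p that] by simp
        qed (rule aff g; assumption?)+
      qed
    qed
  qed
qed

end
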